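(* Let $A$ be a bounded automaton over a finite alphabet $X$ with at least two letters. There exists a deterministic finite-state acceptor $R$ with input alphabet $X$, which can be constructed algorithmically from $A$, with the following property: a sequence $w\in X^{\omega}$ has a finite $G_A$-orbit if and only if the machine $R$, started in its initial state and processing the sequence $w$ letter by letter, passes through accepting states only finitely many times.
   Context: A finite automaton over a finite alphabet $X$ ($|X|\ge 2$) is a tuple $A=(S,X,\pi)$ with $S$ a finite set of states and $\pi:S\times X\to X\times S$; write $s\xrightarrow{x|y}t$ when $\pi(s,x)=(y,t)$. Each state $s$ defines a length-preserving transformation of $X^*$: $s(x_1\ldots x_n)=y_1\ldots y_n$ if there is a path $s=s_1\xrightarrow{x_1|y_1}s_2\xrightarrow{x_2|y_2}\cdots\xrightarrow{x_n|y_n}s_{n+1}$; the final state $s_{n+1}$ is the section $s|_v$ of $s$ at $v=x_1\ldots x_n$. This action extends naturally to the space $X^\omega$ of right-infinite words. All automata are assumed minimal, i.e. different states define different transformations, and states are identified with the transformations they define; $e$ denotes the identity transformation (the trivial state). $A$ is invertible if every state defines an invertible transformation; then the automaton group $G_A$ is the group generated under composition by the transformations defined by the states of $A$; it acts on $X^*$ and on $X^\omega$. An invertible finite automaton $A$ is bounded if there is a constant $C$ such that $|\{v\in X^n : s|_v\neq e\}|\le C$ for all $n\in\mathbb{N}$ and all states $s$ of $A$. A deterministic finite-state acceptor over $X$ consists of a finite set of states, an initial state, a transition function from (states)$\times X$ to states, and a set of accepting states. *)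

theory Defs
  imports
    "HOL-Algebra.Bij"
    "HOL-Algebra.Generated_Groups"
    "HOL-Library.Nat_Bijection"
    "HOL-Library.Omega_Words_Fun"
begin

section \<open>Automata and their transformations\<close>

record ('s, 'x) automaton =
  states :: "'s set"
  alphabet :: "'x set"
  step :: "'s \<times> 'x \<Rightarrow> 'x \<times> 's"

definition finite_automaton :: "('s, 'x) automaton \<Rightarrow> bool" where
  "finite_automaton A \<longleftrightarrow>
     finite (states A) \<and> finite (alphabet A) \<and> card (alphabet A) \<ge> 2 \<and>
     step A \<in> states A \<times> alphabet A \<rightarrow> alphabet A \<times> states A"

fun act :: "('s, 'x) automaton \<Rightarrow> 's \<Rightarrow> 'x list \<Rightarrow> 'x list" where
  "act A s [] = []"
| "act A s (x # v) = (case step A (s, x) of (y, t) \<Rightarrow> y # act A t v)"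

fun state_section :: "('s, 'x) automaton \<Rightarrow> 's \<Rightarrow> 'x list \<Rightarrow> 's" where
  "state_section A s [] = s"
| "state_section A s (x # v) = (case step A (s, x) of (y, t) \<Rightarrow> state_section A t v)"

text \<open>Restricting to the words over the alphabet makes equality of HOL functions coincide with
  equality of transformations of \<open>X\<^sup>*\<close>, and the identity equal to the unit of
  \<^const>\<open>BijGroup\<close>.\<close>

definition transformation :: "('s, 'x) automaton \<Rightarrow> 's \<Rightarrow> 'x list \<Rightarrow> 'x list" where
  "transformation A s = restrict (act A s) (lists (alphabet A))"

definition trivial_state :: "('s, 'x) automaton \<Rightarrow> 's \<Rightarrow> bool" where
  "trivial_state A s \<longleftrightarrow> transformation A s = (\<lambda>v \<in> lists (alphabet A). v)"

definition minimal_automaton :: "('s, 'x) automaton \<Rightarrow> bool" where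
  "minimal_automaton A \<longleftrightarrow> inj_on (transformation A) (states A)"

definition invertible_automaton :: "('s, 'x) automaton \<Rightarrow> bool" where
  "invertible_automaton A \<longleftrightarrow> (\<forall>s \<in> states A. transformation A s \<in> Bij (lists (alphabet A)))"

definition bounded_automaton :: "('s, 'x) automaton \<Rightarrow> bool" where
  "bounded_automaton A \<longleftrightarrow>
     finite_automaton A \<and> minimal_automaton A \<and> invertible_automaton A \<and>
     (\<exists>C. \<forall>n. \<forall>s \<in> states A.
        card {v \<in> lists (alphabet A). length v = n \<and> \<not> trivial_state A (state_section A s v)} \<le> C)"

definition automaton_group :: "('s, 'x) automaton \<Rightarrow> ('x list \<Rightarrow> 'x list) set" where
  "automaton_group A =
     generate (BijGroup (lists (alphabet A))) (transformation A ` states A)"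


section \<open>The action on infinite words\<close>

text \<open>The elements of an automaton group preserve lengths and prefixes, so the images of the finite
  prefixes of \<open>w\<close> are the prefixes of one infinite word.\<close>

definition omega_act :: "('x list \<Rightarrow> 'x list) \<Rightarrow> 'x word \<Rightarrow> 'x word" where
  "omega_act g w = (\<lambda>i. g (prefix (Suc i) w) ! i)"

definition omega_orbit :: "('s, 'x) automaton \<Rightarrow> 'x word \<Rightarrow> 'x word set" where
  "omega_orbit A w = {omega_act g w | g. g \<in> automaton_group A}"


section \<open>Acceptors\<close>

record ('q, 'x) acceptor =
  acc_states :: "'q set"
  initial :: "'q"
  trans_fun :: "'q \<Rightarrow> 'x \<Rightarrow> 'q"
  accepting :: "'q set"

definition finite_acceptor :: "'x set \<Rightarrow> ('q, 'x) acceptor \<Rightarrow> bool" where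
  "finite_acceptor X R \<longleftrightarrow>
     finite (acc_states R) \<and> initial R \<in> acc_states R \<and> accepting R \<subseteq> acc_states R \<and>
     (\<forall>q \<in> acc_states R. \<forall>x \<in> X. trans_fun R q x \<in> acc_states R)"

fun run :: "('q, 'x) acceptor \<Rightarrow> 'x word \<Rightarrow> nat \<Rightarrow> 'q" where
  "run R w 0 = initial R"
| "run R w (Suc i) = trans_fun R (run R w i) (w i)"

definition accepts_finitely_often :: "('q, 'x) acceptor \<Rightarrow> 'x word \<Rightarrow> bool" where
  "accepts_finitely_often R w \<longleftrightarrow> finite {i. run R w i \<in> accepting R}"


section \<open>Algorithms\<close>

text \<open>The total recursive functions on the natural numbers, in the unary presentation in which
  several arguments are passed through the Cantor pairing. Minimization is applied to regular
  functions only; by Kleene's normal form theorem this still yields every total recursive function,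
  and only those.\<close>

inductive total_recursive :: "(nat \<Rightarrow> nat) \<Rightarrow> bool" where
  zero: "total_recursive (\<lambda>_. 0)"
| succ: "total_recursive Suc"
| left: "total_recursive (\<lambda>n. fst (prod_decode n))"
| right: "total_recursive (\<lambda>n. snd (prod_decode n))"
| pair: "total_recursive f \<Longrightarrow> total_recursive g \<Longrightarrow>
    total_recursive (\<lambda>n. prod_encode (f n, g n))"
| comp: "total_recursive f \<Longrightarrow> total_recursive g \<Longrightarrow> total_recursive (\<lambda>n. f (g n))"
| prim_rec: "total_recursive f \<Longrightarrow> total_recursive g \<Longrightarrow>
    total_recursive (\<lambda>n. case prod_decode n of (a, m) \<Rightarrow>
      rec_nat (f a) (\<lambda>k r. g (prod_encode (a, prod_encode (k, r)))) m)"
| minimize: "total_recursive f \<Longrightarrow> (\<And>a. \<exists>m. f (prod_encode (a, m)) = 0) \<Longrightarrow>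
    total_recursive (\<lambda>a. LEAST m. f (prod_encode (a, m)) = 0)"

text \<open>Finite machines are presented to an algorithm by their tables, relative to an enumeration of
  the states and one of the letters. A presentation determines the machine up to renaming of
  states and letters.\<close>

definition enumerates :: "'a list \<Rightarrow> 'a set \<Rightarrow> bool" where
  "enumerates xs S \<longleftrightarrow> distinct xs \<and> set xs = S"

definition position :: "'a list \<Rightarrow> 'a \<Rightarrow> nat" where
  "position xs x = (LEAST i. i < length xs \<and> xs ! i = x)"

definition automaton_code :: "'s list \<Rightarrow> 'x list \<Rightarrow> ('s, 'x) automaton \<Rightarrow> nat" where
  "automaton_code ss xs A =
     prod_encode (length xs,
       list_encode (map (\<lambda>s. list_encode (map (\<lambda>x. case step A (s, x) of (y, t) \<Rightarrow>
         prod_encode (position xs y, position ss t)) xs)) ss))"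

definition acceptor_code :: "'q list \<Rightarrow> 'x list \<Rightarrow> ('q, 'x) acceptor \<Rightarrow> nat" where
  "acceptor_code qs xs R =
     list_encode
       [position qs (initial R),
        list_encode (map (\<lambda>q. list_encode (map (\<lambda>x. position qs (trans_fun R q x)) xs)) qs),
        list_encode (map (\<lambda>q. if q \<in> accepting R then 1 else 0) qs)]"

end

theory Submission
  imports Defs
begin

text \<open>
  The orbit of \<open>w\<close> is infinite iff infinitely often a prefix \<open>u x\<close> of \<open>w\<close> (\<open>x\<close> a letter) lies in the
  orbit of some \<open>u y\<close> with \<open>y \<noteq> x\<close>. To detect this, split the orbit of \<open>u\<close> into tiles, the
  components of the graph of all moves \<open>v \<mapsto> s v\<close> whose section \<open>s|\<^sub>v\<close> is trivial. Only the moves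
  between tiles, labelled by their sections, influence the next letter, so the finite graph of tiles
  with the tile of \<open>u\<close> marked determines the one of \<open>u x\<close>: take a copy of it for every letter, read
  the labels on these letters, contract the edges that became trivial and keep the component of the
  marked vertex. Boundedness enters once: in a bounded automaton with \<open>m\<close> states and \<open>k\<close> letters an
  orbit has at most \<open>2 m k\<^bsup>2m\<^esup> + 1\<close> tiles, so these graphs, with the tiles numbered canonically, are the
  states of a finite acceptor. It is computed from the table of the automaton with bounded
  quantifiers only, connectedness being quantified over the saturated vertex sets.
\<close>


section \<open>Recursive functions\<close>

text \<open>The constant C of boundedness is only asserted to exist, so nothing computed from the
  table may depend on it. It serves solely to exclude that a path leaves one cycle and meets another
  one in a nontrivial state. This structural fact bounds the active words of each state, at every
  length, by a number that depends on m and k alone, and with them the tiles. Tiles can serve as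
  vertices because a trivial section copies all further letters: a tile survives at the next level,
  once for every letter, and can only merge with others. Moreover sections of trivial states are
  trivial, so a nontrivial edge after a letter stems from a nontrivial edge before it, and the moves
  inside a tile can be forgotten for good. The numbering of the tiles has to be a function of the
  old graph and the letter, since it is part of the state of a deterministic machine; ranks of least
  vertices provide it and stay below the bound on tiles. The algorithm must be total on all numbers,
  including those that code no automaton, so every search in it has a built-in end.\<close>

abbreviation pfst :: "nat \<Rightarrow> nat" where "pfst n \<equiv> fst (prod_decode n)"
abbreviation psnd :: "nat \<Rightarrow> nat" where "psnd n \<equiv> snd (prod_decode n)"

definition decidable :: "(nat \<Rightarrow> bool) \<Rightarrow> bool" where
  "decidable P \<longleftrightarrow> total_recursive (\<lambda>a. of_bool (P a))"

named_theorems recursive_intros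

lemma total_recursive_id [recursive_intros]: "total_recursive (\<lambda>n. n)"
  using total_recursive.pair[OF total_recursive.left total_recursive.right] by simp

lemma total_recursive_const [recursive_intros]: "total_recursive (\<lambda>_. c)"
  by (induction c) (auto intro: total_recursive.zero total_recursive.comp[OF total_recursive.succ])

lemmas total_recursive_Suc [recursive_intros] = total_recursive.comp[OF total_recursive.succ]
lemmas total_recursive_pfst [recursive_intros] = total_recursive.comp[OF total_recursive.left]
lemmas total_recursive_psnd [recursive_intros] = total_recursive.comp[OF total_recursive.right]
declare total_recursive.pair [recursive_intros]

text \<open>The variables bound in the body become projections of a single argument. Rules of this
  form apply by resolution, so recursiveness of a term can be proved by following its
  syntax.\<close>

lemma total_recursive_rec_nat [recursive_intros]:
  assumes "total_recursive f" "total_recursive (\<lambda>n. g (pfst n) (pfst (psnd n)) (psnd (psnd n)))"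
    "total_recursive m"
  shows "total_recursive (\<lambda>a. rec_nat (f a) (\<lambda>k r. g a k r) (m a))"
proof -
  have "total_recursive (\<lambda>a. (\<lambda>n. case prod_decode n of (a, m) \<Rightarrow>
      rec_nat (f a) (\<lambda>k r. (\<lambda>n. g (pfst n) (pfst (psnd n)) (psnd (psnd n)))
         (prod_encode (a, prod_encode (k, r)))) m) (prod_encode (a, m a)))"
    by (intro total_recursive.comp[OF total_recursive.prim_rec] assms total_recursive.pair
        total_recursive_id)
  then show ?thesis by simp
qed

lemma total_recursive_plus [recursive_intros]:
  assumes "total_recursive f" "total_recursive g"
  shows "total_recursive (\<lambda>a. f a + g a)"
proof -
  have "rec_nat x (\<lambda>_ r. Suc r) n = x + n" for x n by (induction n) auto
  moreover have "total_recursive (\<lambda>a. rec_nat (f a) (\<lambda>k r. Suc r) (g a))"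
    by (intro recursive_intros assms)
  ultimately show ?thesis by simp
qed

lemma total_recursive_minus [recursive_intros]:
  assumes "total_recursive f" "total_recursive g"
  shows "total_recursive (\<lambda>a. f a - g a)"
proof -
  have pred: "rec_nat 0 (\<lambda>k _. k) n = n - 1" for n :: nat by (cases n) auto
  have "rec_nat x (\<lambda>_ r. rec_nat 0 (\<lambda>k _. k) r) n = x - n" for x n
    by (induction n) (auto simp: pred)
  moreover have "total_recursive (\<lambda>a. rec_nat (f a) (\<lambda>_ r. rec_nat 0 (\<lambda>k _. k) r) (g a))"
    by (intro recursive_intros assms)
  ultimately show ?thesis by simp
qed

lemma total_recursive_times [recursive_intros]:
  assumes "total_recursive f" "total_recursive g"
  shows "total_recursive (\<lambda>a. f a * g a)"
proof -
  have "rec_nat 0 (\<lambda>_ r. r + x) n = x * n" for x n :: nat by (induction n) auto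
  moreover have "total_recursive (\<lambda>a. rec_nat 0 (\<lambda>_ r. r + f a) (g a))"
    by (intro recursive_intros assms[THEN total_recursive.comp])
  ultimately show ?thesis by simp
qed

lemma total_recursive_power [recursive_intros]:
  assumes "total_recursive f" "total_recursive g"
  shows "total_recursive (\<lambda>a. f a ^ g a)"
proof -
  have "rec_nat 1 (\<lambda>_ r. r * x) n = x ^ n" for x n :: nat by (induction n) auto
  moreover have "total_recursive (\<lambda>a. rec_nat 1 (\<lambda>_ r. r * f a) (g a))"
    by (intro recursive_intros assms[THEN total_recursive.comp])
  ultimately show ?thesis by simp
qed

lemma total_recursive_sum [recursive_intros]:
  assumes "total_recursive n" "total_recursive (\<lambda>a. F (pfst a) (psnd a))"
  shows "total_recursive (\<lambda>a. \<Sum>i<n a. F a i)"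
proof -
  have F: "total_recursive (\<lambda>a. F (f a) (g a))" if "total_recursive f" "total_recursive g" for f g
    using total_recursive.comp[OF assms(2) total_recursive.pair[OF that]] by simp
  have "rec_nat 0 (\<lambda>k r. r + F a k) m = (\<Sum>i<m. F a i)" for a m by (induction m) auto
  moreover have "total_recursive (\<lambda>a. rec_nat 0 (\<lambda>k r. r + F a k) (n a))"
    by (intro recursive_intros assms(1) F)
  ultimately show ?thesis by simp
qed

lemma decidable_const [recursive_intros]: "decidable (\<lambda>_. b)"
  unfolding decidable_def by (intro recursive_intros)

lemma decidable_not [recursive_intros]:
  assumes "decidable P" shows "decidable (\<lambda>a. \<not> P a)"
proof -
  have "total_recursive (\<lambda>a. 1 - of_bool (P a))"
    by (intro recursive_intros assms[unfolded decidable_def])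
  moreover have "1 - of_bool b = (of_bool (\<not> b) :: nat)" for b by auto
  ultimately show ?thesis by (simp add: decidable_def)
qed

lemma decidable_conj [recursive_intros]:
  assumes "decidable P" "decidable Q" shows "decidable (\<lambda>a. P a \<and> Q a)"
  unfolding decidable_def of_bool_conj by (intro recursive_intros assms[unfolded decidable_def])

lemma decidable_disj [recursive_intros]:
  assumes "decidable P" "decidable Q" shows "decidable (\<lambda>a. P a \<or> Q a)"
proof -
  have "decidable (\<lambda>a. \<not> (\<not> P a \<and> \<not> Q a))" by (intro recursive_intros assms)
  then show ?thesis by simp
qed

lemma decidable_imp [recursive_intros]:
  assumes "decidable P" "decidable Q" shows "decidable (\<lambda>a. P a \<longrightarrow> Q a)"
  unfolding imp_conv_disj by (intro recursive_intros assms)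

lemma decidable_iff [recursive_intros]:
  assumes "decidable P" "decidable Q" shows "decidable (\<lambda>a. P a \<longleftrightarrow> Q a)"
  unfolding iff_conv_conj_imp by (intro recursive_intros assms)

lemma decidable_le [recursive_intros]:
  assumes "total_recursive f" "total_recursive g" shows "decidable (\<lambda>a. f a \<le> g a)"
proof -
  have "of_bool (m \<le> n) = 1 - (m - n)" for m n :: nat by auto
  then show ?thesis unfolding decidable_def by (simp only:) (intro recursive_intros assms)
qed

lemma decidable_less [recursive_intros]:
  assumes "total_recursive f" "total_recursive g" shows "decidable (\<lambda>a. f a < g a)"
  unfolding less_eq_Suc_le by (intro recursive_intros assms)

lemma decidable_eq [recursive_intros]:
  fixes f g :: "nat \<Rightarrow> nat"
  assumes "total_recursive f" "total_recursive g" shows "decidable (\<lambda>a. f a = g a)"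
  unfolding order_eq_iff by (intro recursive_intros assms)

text \<open>The number of counterexamples is a bounded sum, and it vanishes iff the quantified
  statement holds.\<close>

lemma decidable_ball_less [recursive_intros]:
  assumes "total_recursive n" "decidable (\<lambda>a. P (pfst a) (psnd a))"
  shows "decidable (\<lambda>a. \<forall>i<n a. P a i)"
proof -
  have *: "(\<forall>i<m. P a i) \<longleftrightarrow> (\<Sum>i<m. of_bool (\<not> P a i)) = (0 :: nat)" for a m by auto
  show ?thesis unfolding *
    by (intro recursive_intros assms decidable_not[unfolded decidable_def] assms(2)[unfolded decidable_def])
qed

lemma decidable_bex_less [recursive_intros]:
  assumes "total_recursive n" "decidable (\<lambda>a. P (pfst a) (psnd a))"
  shows "decidable (\<lambda>a. \<exists>i<n a. P a i)"
proof -
  have "decidable (\<lambda>a. \<not> (\<forall>i<n a. \<not> P a i))" by (intro recursive_intros assms)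
  then show ?thesis by simp
qed

lemma total_recursive_of_bool [recursive_intros]:
  "decidable P \<Longrightarrow> total_recursive (\<lambda>a. of_bool (P a))"
  by (simp add: decidable_def)

lemma total_recursive_if [recursive_intros]:
  assumes "decidable P" "total_recursive f" "total_recursive g"
  shows "total_recursive (\<lambda>a. if P a then f a else g a)"
proof -
  have "(if b then x else y) = of_bool b * x + of_bool (\<not> b) * y" for b and x y :: nat by auto
  then show ?thesis by (simp only:) (intro recursive_intros assms)
qed

lemma total_recursive_Least:
  assumes "decidable (\<lambda>a. P (pfst a) (psnd a))" "\<And>a. \<exists>i. P a i"
  shows "total_recursive (\<lambda>a. LEAST i. P a i)"
proof -
  let ?f = "\<lambda>a. of_bool (\<not> P (pfst a) (psnd a)) :: nat"
  have "total_recursive (\<lambda>a. LEAST i. ?f (prod_encode (a, i)) = 0)"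
    using assms by (intro total_recursive.minimize recursive_intros) auto
  then show ?thesis by simp
qed

text \<open>The disjunct \<open>i = n a\<close> ends the search for every argument, as minimization
  demands; \<open>n a\<close> is the default value when no smaller index qualifies.\<close>

lemma total_recursive_bounded_Least [recursive_intros]:
  assumes "total_recursive n" "decidable (\<lambda>a. P (pfst a) (psnd a))"
  shows "total_recursive (\<lambda>a. LEAST i. i = n a \<or> P a i)"
  by (intro total_recursive_Least recursive_intros assms assms(1)[THEN total_recursive.comp]) auto


section \<open>Finite sets of numbers as bit patterns\<close>

definition bit_set :: "nat \<Rightarrow> nat \<Rightarrow> bool" where
  "bit_set q i \<longleftrightarrow> i \<in> set_decode q"

text \<open>\<open>set_decode\<close> tests the parity of a quotient. Writing \<open>q\<close> as an
  odd multiple of \<open>2 ^ i\<close> plus a remainder replaces the division by bounded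
  quantifiers, for which closure rules are available.\<close>

lemma bit_set_iff: "bit_set q i \<longleftrightarrow> (\<exists>z<Suc q. \<exists>r<2 ^ i. q = (2 * z + 1) * 2 ^ i + r)"
proof
  assume "bit_set q i"
  then have "odd (q div 2 ^ i)" by (simp add: bit_set_def set_decode_def)
  then obtain z where "q div 2 ^ i = 2 * z + 1" by (elim oddE)
  then have eq: "q = (2 * z + 1) * 2 ^ i + q mod 2 ^ i" by (metis div_mult_mod_eq)
  moreover have "z * 1 \<le> (2 * z + 1) * 2 ^ i" by (intro mult_mono) auto
  then have "z < Suc q" using eq by linarith
  moreover have "q mod 2 ^ i < 2 ^ i" by simp
  ultimately show "\<exists>z<Suc q. \<exists>r<2 ^ i. q = (2 * z + 1) * 2 ^ i + r" by blast
next
  assume "\<exists>z<Suc q. \<exists>r<2 ^ i. q = (2 * z + 1) * 2 ^ i + r"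
  then obtain z r where "r < 2 ^ i" "q = (2 * z + 1) * 2 ^ i + r" by blast
  then have "q div 2 ^ i = 2 * z + 1" by (simp only: div_mult_self3) simp
  then show "bit_set q i" by (simp add: bit_set_def set_decode_def)
qed

lemma decidable_bit_set [recursive_intros]:
  assumes "total_recursive f" "total_recursive g"
  shows "decidable (\<lambda>a. bit_set (f a) (g a))"
  unfolding bit_set_iff by (intro recursive_intros assms assms[THEN total_recursive.comp])

text \<open>The cut at \<open>K\<close> keeps the number below \<open>2 ^ K\<close>, so that
  quantifying over the subsets of \<open>{..<K}\<close> is a bounded quantifier over
  numbers.\<close>

definition bit_comprehension :: "nat \<Rightarrow> (nat \<Rightarrow> bool) \<Rightarrow> nat" where
  "bit_comprehension K P = (\<Sum>i<K. if P i then 2 ^ i else 0)"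

lemma bit_comprehension_eq: "bit_comprehension K P = set_encode {i. i < K \<and> P i}"
  unfolding bit_comprehension_def set_encode_def
  by (subst sum.inter_filter[symmetric]) (auto intro: sum.cong)

lemma bit_set_comprehension [simp]: "bit_set (bit_comprehension K P) i \<longleftrightarrow> i < K \<and> P i"
  by (simp add: bit_comprehension_eq bit_set_def)

lemma bit_comprehension_less: "bit_comprehension K P < 2 ^ K"
proof -
  have "bit_comprehension K P \<le> (\<Sum>i<K. 2 ^ i)"
    unfolding bit_comprehension_def by (intro sum_mono) auto
  also have "\<dots> < 2 ^ K" by (induction K) auto
  finally show ?thesis .
qed

lemma total_recursive_bit_comprehension [recursive_intros]:
  assumes "total_recursive n" "decidable (\<lambda>a. P (pfst a) (psnd a))"
  shows "total_recursive (\<lambda>a. bit_comprehension (n a) (\<lambda>i. P a i))"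
  unfolding bit_comprehension_def by (intro recursive_intros assms)


section \<open>Access to lists coded by numbers\<close>

definition code_drop :: "nat \<Rightarrow> nat \<Rightarrow> nat" where
  "code_drop c i = rec_nat c (\<lambda>_ r. psnd (r - 1)) i"

definition code_nth :: "nat \<Rightarrow> nat \<Rightarrow> nat" where
  "code_nth c i = pfst (code_drop c i - 1)"

definition code_length :: "nat \<Rightarrow> nat" where
  "code_length c = (LEAST i. code_drop c i = 0)"

text \<open>The code of a nonempty list is the successor of a pair code, so
  \<open>psnd (r - 1)\<close> is its tail. The code 0 of the empty list is a fixed point because
  \<open>prod_decode 0 = (0, 0)\<close>, so dropping past the end is harmless.\<close>

lemma code_drop_list_encode: "code_drop (list_encode l) i = list_encode (drop i l)"
proof (induction i)
  case 0
  then show ?case by (simp add: code_drop_def)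
next
  case (Suc i)
  have "code_drop (list_encode l) (Suc i) = psnd (list_encode (drop i l) - 1)"
    using Suc by (simp add: code_drop_def)
  also have "\<dots> = list_encode (tl (drop i l))"
  proof (cases "drop i l")
    case Nil
    have "prod_decode 0 = (0, 0)" by (simp add: prod_decode_def prod_decode_aux.simps)
    with Nil show ?thesis by simp
  qed simp
  finally show ?case by (simp add: drop_Suc tl_drop)
qed

lemma code_nth_list_encode [simp]: "i < length l \<Longrightarrow> code_nth (list_encode l) i = l ! i"
  by (simp add: code_nth_def code_drop_list_encode flip: Cons_nth_drop_Suc)

lemma code_drop_list_encode_eq_0: "code_drop (list_encode l) i = 0 \<longleftrightarrow> length l \<le> i"
  by (cases "drop i l") (use drop_eq_Nil[of i l] in \<open>auto simp: code_drop_list_encode\<close>)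

lemma code_length_list_encode [simp]: "code_length (list_encode l) = length l"
  by (auto simp: code_length_def code_drop_list_encode_eq_0 intro: Least_equality)

lemma total_recursive_code_drop [recursive_intros]:
  assumes "total_recursive f" "total_recursive g"
  shows "total_recursive (\<lambda>a. code_drop (f a) (g a))"
  unfolding code_drop_def by (intro recursive_intros assms)

lemma total_recursive_code_nth [recursive_intros]:
  assumes "total_recursive f" "total_recursive g"
  shows "total_recursive (\<lambda>a. code_nth (f a) (g a))"
  unfolding code_nth_def by (intro recursive_intros assms)

text \<open>The minimization is regular because every number codes some list.\<close>

lemma total_recursive_code_length [recursive_intros]:
  assumes "total_recursive f"
  shows "total_recursive (\<lambda>a. code_length (f a))"
  unfolding code_length_def
proof (intro total_recursive_Least recursive_intros assms[THEN total_recursive.comp])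
  show "\<exists>i. code_drop (f a) i = 0" for a
    using code_drop_list_encode_eq_0[of "list_decode (f a)"] by (auto simp: list_decode_inverse)
qed

text \<open>A list code is built from the back: after \<open>m\<close> rounds the recursion holds
  the code of the last \<open>m\<close> entries, whence the index \<open>n - Suc j\<close>.\<close>

lemma list_encode_map_upt:
  "list_encode (map F [0..<n]) = rec_nat 0 (\<lambda>j r. Suc (prod_encode (F (n - Suc j), r))) n"
proof -
  have "rec_nat 0 (\<lambda>j r. Suc (prod_encode (F (n - Suc j), r))) m = list_encode (map F [n - m..<n])"
    if "m \<le> n" for m
    using that
  proof (induction m)
    case (Suc m)
    then have "[n - Suc m..<n] = (n - Suc m) # [n - m..<n]"
      by (metis Suc_diff_Suc Suc_le_lessD diff_less upt_conv_Cons zero_less_Suc less_le_trans)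
    with Suc show ?case by simp
  qed simp
  from this[of n] show ?thesis by simp
qed

lemma total_recursive_list_encode_map_upt [recursive_intros]:
  assumes "total_recursive n" "total_recursive (\<lambda>a. F (pfst a) (psnd a))"
  shows "total_recursive (\<lambda>a. list_encode (map (\<lambda>i. F a i) [0..<n a]))"
proof -
  have F: "total_recursive (\<lambda>a. F (f a) (g a))" if "total_recursive f" "total_recursive g" for f g
    using total_recursive.comp[OF assms(2) total_recursive.pair[OF that]] by simp
  show ?thesis unfolding list_encode_map_upt
    by (intro recursive_intros F assms(1) assms(1)[THEN total_recursive.comp])
qed

text \<open>Bounds on the components bound the code of a pair; this is the origin of the shape of
  \<open>vertex_bound\<close> and \<open>fact_bound\<close>.\<close>

lemma prod_encode_mono: "a \<le> a' \<Longrightarrow> b \<le> b' \<Longrightarrow> prod_encode (a, b) \<le> prod_encode (a', b')"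
proof -
  assume *: "a \<le> a'" "b \<le> b'"
  have "triangle m \<le> triangle n" if "m \<le> n" for m n
    using that by (induction rule: dec_induct) auto
  with * show ?thesis by (simp add: prod_encode_def add_mono)
qed


section \<open>Active words of a bounded automaton\<close>

lemma act_append: "act A s (u @ v) = act A s u @ act A (state_section A s u) v"
  by (induction u arbitrary: s) (auto split: prod.split)

lemma state_section_append:
  "state_section A s (u @ v) = state_section A (state_section A s u) v"
  by (induction u arbitrary: s) (auto split: prod.split)

lemma length_act [simp]: "length (act A s v) = length v"
  by (induction v arbitrary: s) (auto split: prod.split)

lemma step_closed:
  assumes "finite_automaton A" "s \<in> states A" "x \<in> alphabet A"
  shows "fst (step A (s, x)) \<in> alphabet A" "snd (step A (s, x)) \<in> states A"
  using assms by (auto simp: finite_automaton_def Pi_iff mem_Times_iff)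

lemma act_state_section_closed:
  assumes "finite_automaton A" "s \<in> states A" "v \<in> lists (alphabet A)"
  shows "act A s v \<in> lists (alphabet A) \<and> state_section A s v \<in> states A"
  using assms(3,2)
proof (induction v arbitrary: s rule: lists.induct)
  case (Cons x v)
  obtain y t where yt: "step A (s, x) = (y, t)" by fastforce
  then have "y \<in> alphabet A" "t \<in> states A"
    using step_closed[OF assms(1), of s x] Cons by auto
  then show ?case using Cons.IH[of t] yt by simp
qed auto

lemmas act_closed = act_state_section_closed[THEN conjunct1]
lemmas state_section_closed = act_state_section_closed[THEN conjunct2]

lemma trivial_state_iff: "trivial_state A s \<longleftrightarrow> (\<forall>v\<in>lists (alphabet A). act A s v = v)"
  unfolding trivial_state_def transformation_def restrict_def by (auto simp: fun_eq_iff)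

lemma trivial_state_section:
  assumes "trivial_state A s" "u \<in> lists (alphabet A)"
  shows "trivial_state A (state_section A s u)"
  unfolding trivial_state_iff
proof
  fix v assume "v \<in> lists (alphabet A)"
  then have "act A s (u @ v) = u @ v" "act A s u = u"
    using assms by (auto simp: trivial_state_iff)
  then show "act A (state_section A s u) v = v" by (simp add: act_append)
qed

lemma trivial_state_step:
  assumes "trivial_state A s" "x \<in> alphabet A"
  shows "fst (step A (s, x)) = x" "trivial_state A (snd (step A (s, x)))"
proof -
  have x: "[x] \<in> lists (alphabet A)" using assms(2) by simp
  then have "act A s [x] = [x]" using assms(1) unfolding trivial_state_iff by blast
  then show "fst (step A (s, x)) = x" by (auto split: prod.splits)
  show "trivial_state A (snd (step A (s, x)))"
    using trivial_state_section[OF assms(1) x] by (auto split: prod.splits)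
qed

lemma nth_concat_replicate:
  "t < i * length a \<Longrightarrow> concat (replicate i a) ! t = a ! (t mod length a)"
proof (induction i arbitrary: t)
  case (Suc i)
  then show ?case
    by (cases "t < length a") (auto simp: nth_append le_mod_geq)
qed simp

lemma length_concat_replicate [simp]: "length (concat (replicate i a)) = i * length a"
  by (induction i) auto

lemma state_section_concat_replicate:
  "state_section A r a = r \<Longrightarrow> state_section A r (concat (replicate i a)) = r"
  by (induction i) (auto simp: state_section_append)

lemma concat_replicate_in_lists: "a \<in> lists X \<Longrightarrow> concat (replicate i a) \<in> lists X"
  by (induction i) auto

section \<open>Counting active words\<close>

definition active_words :: "('s, 'x) automaton \<Rightarrow> 's \<Rightarrow> nat \<Rightarrow> 'x list set" where
  "active_words A s n =
     {v \<in> lists (alphabet A). length v = n \<and> \<not> trivial_state A (state_section A s v)}"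

lemma words_eq: "{v \<in> lists X. length v = n} = {v. set v \<subseteq> X \<and> length v = n}"
  by auto

lemma finite_words: "finite X \<Longrightarrow> finite {v \<in> lists X. length v = n}"
  unfolding words_eq by (rule finite_lists_length_eq)

lemma card_words: "finite X \<Longrightarrow> card {v \<in> lists X. length v = n} = card X ^ n"
  unfolding words_eq by (rule card_lists_length_eq)

lemma finite_active_words: "finite (alphabet A) \<Longrightarrow> finite (active_words A s n)"
  by (rule finite_subset[OF _ finite_words[of "alphabet A" n]]) (auto simp: active_words_def)

text \<open>A path leaving the cycle \<open>a\<close> and running into another cycle \<open>b\<close> can leave after any number of
  turns, so the number of active words grows linearly.\<close>

lemma no_cycle_to_cycle:
  assumes A: "finite_automaton A"
    and C: "\<And>n. card (active_words A r n) \<le> C"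
    and a: "a \<in> lists (alphabet A)" "a \<noteq> []" "state_section A r a = r"
    and y: "y \<in> lists (alphabet A)" "t < length y" "y ! t \<noteq> a ! (t mod length a)"
    and b: "b \<in> lists (alphabet A)" "b \<noteq> []"
      "state_section A (state_section A r y) b = state_section A r y"
    and nontriv: "\<not> trivial_state A (state_section A r y)"
  shows False
proof -
  define l where "l = length a"
  \<comment> \<open>\<open>dev w\<close> is the first place where \<open>w\<close> leaves the
    periodic word with period \<open>a\<close>. Each turn around the cycle delays it by
    \<open>l\<close>, so it tells the words \<open>w i\<close> apart.\<close>
  define dev where "dev w = (LEAST t. w ! t \<noteq> a ! (t mod l))" for w
  define z where "z = concat (replicate (C * l) b)"
  \<comment> \<open>\<open>w i\<close> makes \<open>i\<close> turns around \<open>a\<close>, leaves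
    along \<open>y\<close> and then circles in \<open>b\<close>. The last part is cut so that all
    words with \<open>i \<le> C\<close> have the same length; \<open>z\<close> is long enough for
    every cut because \<open>b\<close> is nonempty.\<close>
  define w where "w i = concat (replicate i a) @ y @ take ((C - i) * l) z" for i
  have l: "l > 0" using a by (simp add: l_def)
  have z: "C * l \<le> length z" using b(2) by (simp add: z_def Suc_le_eq)
  have z_in: "z \<in> lists (alphabet A)" unfolding z_def by (rule concat_replicate_in_lists[OF b(1)])
  define t0 where "t0 = dev y"
  have t: "y ! t \<noteq> a ! (t mod l)" using y(3) by (simp add: l_def)
  have t0: "y ! t0 \<noteq> a ! (t0 mod l)" "t0 \<le> t"
    unfolding t0_def dev_def using t by (rule LeastI, rule Least_le)
  have before_t0: "y ! j = a ! (j mod l)" if "j < t0" for j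
    using not_less_Least[OF that[unfolded t0_def dev_def]] by blast
  have dev: "dev (w i) = i * l + t0" for i
    unfolding dev_def
  proof (rule Least_equality)
    show "w i ! (i * l + t0) \<noteq> a ! ((i * l + t0) mod l)"
      using t0 y(2) by (simp add: w_def nth_append l_def)
    fix j assume j: "w i ! j \<noteq> a ! (j mod l)"
    show "i * l + t0 \<le> j"
    proof (rule ccontr)
      assume *: "\<not> i * l + t0 \<le> j"
      show False
      proof (cases "j < i * l")
        case True
        then show False using j by (simp add: w_def nth_append l_def nth_concat_replicate)
      next
        case False
        define k where "k = j - i * l"
        have k: "j = i * l + k" "k < t0" using * False by (auto simp: k_def)
        then have "w i ! j = y ! k" using t0(2) y(2) by (simp add: w_def nth_append l_def)
        with before_t0[OF k(2)] j show False by (simp add: k(1))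
      qed
    qed
  qed
  have inj: "inj_on w {..C}"
  proof (rule inj_onI)
    fix i j assume "w i = w j"
    then have "dev (w i) = dev (w j)" by simp
    then show "i = j" using l by (simp add: dev)
  qed
  define n where "n = C * l + length y"
  have sub: "w ` {..C} \<subseteq> active_words A r n"
  proof safe
    fix i assume i: "i \<le> C"
    have "(C - i) * l \<le> length z" using z by (rule le_trans[rotated]) simp
    then have "length (w i) = i * l + length y + (C - i) * l"
      by (simp add: w_def l_def)
    also have "\<dots> = n" using i by (simp add: n_def diff_mult_distrib)
    finally have len: "length (w i) = n" .
    have tk: "take ((C - i) * l) z \<in> lists (alphabet A)" "drop ((C - i) * l) z \<in> lists (alphabet A)"
      using z_in by (auto dest: in_set_takeD in_set_dropD)
    have "state_section A (state_section A r y) z = state_section A r y"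
      unfolding z_def by (rule state_section_concat_replicate[OF b(3)])
    \<comment> \<open>The cut may fall inside a turn of \<open>b\<close>, but reading the rest of
      \<open>z\<close> returns to the nontrivial state reached by \<open>y\<close>, which no trivial
      state can do.\<close>
    then have eq: "state_section A (state_section A (state_section A r y) (take ((C - i) * l) z))
         (drop ((C - i) * l) z) = state_section A r y"
      by (simp flip: state_section_append)
    have sec: "state_section A r (w i) = state_section A (state_section A r y) (take ((C - i) * l) z)"
      by (simp add: w_def state_section_append state_section_concat_replicate[OF a(3)])
    have "\<not> trivial_state A (state_section A r (w i))"
      using trivial_state_section[OF _ tk(2)] eq nontriv unfolding sec by metis
    moreover have "w i \<in> lists (alphabet A)"
      unfolding w_def append_in_lists_conv using concat_replicate_in_lists[OF a(1)] y(1) tk by blast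
    ultimately show "w i \<in> active_words A r n"
      using len by (simp add: active_words_def)
  qed
  have "Suc C = card (w ` {..C})" by (simp add: card_image[OF inj])
  also have "\<dots> \<le> card (active_words A r n)"
    by (intro card_mono sub finite_active_words) (use A in \<open>simp add: finite_automaton_def\<close>)
  finally show False using C[of n] by simp
qed

text \<open>Pigeonhole on the states met before and after each of the first
  \<open>card (states A)\<close> letters: one more than there are states.\<close>

lemma state_repetition:
  assumes "finite_automaton A" "s \<in> states A" "z \<in> lists (alphabet A)" "card (states A) \<le> length z"
  obtains z1 z2 z3 where "z = z1 @ z2 @ z3" "z2 \<noteq> []" "length (z1 @ z2) \<le> card (states A)"
    "state_section A (state_section A s z1) z2 = state_section A s z1"
proof -
  let ?m = "card (states A)" and ?f = "\<lambda>i. state_section A s (take i z)"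
  have "?f ` {..?m} \<subseteq> states A"
    using assms by (auto intro!: state_section_closed dest: in_set_takeD)
  then have "card (?f ` {..?m}) \<le> ?m"
    using assms(1) by (intro card_mono) (auto simp: finite_automaton_def)
  then have "\<not> inj_on ?f {..?m}"
    using card_image[of ?f "{..?m}"] by auto
  then obtain i j where ij: "i \<le> ?m" "j \<le> ?m" "i < j" "?f i = ?f j"
    unfolding inj_on_def by (metis atMost_iff linorder_neqE_nat)
  define z2 where "z2 = drop i (take j z)"
  have t: "take j z = take i z @ z2" using ij(3)
    by (simp add: z2_def) (metis append_take_drop_id less_imp_le_nat min_def take_take)
  show thesis
  proof (rule that[of "take i z" z2 "drop j z"])
    show "z = take i z @ z2 @ drop j z" using t by (metis append.assoc append_take_drop_id)
    show "z2 \<noteq> []" using ij assms(4) by (simp add: z2_def)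
    show "length (take i z @ z2) \<le> ?m" using ij(2) by (simp flip: t)
    show "state_section A (state_section A s (take i z)) z2 = state_section A s (take i z)"
      using ij(4) unfolding t state_section_append by simp
  qed
qed

text \<open>An active word is determined by its first and its last \<open>m\<close> letters, \<open>m\<close> the number of states:
  of two such words that differ only in the middle, one leaves the cycle met in the first \<open>m\<close> steps
  and meets another one in the last \<open>m\<close> steps.\<close>

lemma card_active_words_le:
  assumes A: "finite_automaton A" and s: "s \<in> states A"
    and C: "\<And>n r. r \<in> states A \<Longrightarrow> card (active_words A r n) \<le> C"
  shows "card (active_words A s n) \<le> card (alphabet A) ^ (2 * card (states A))"
proof -
  let ?X = "alphabet A"
  define m where "m = card (states A)"
  define ends where "ends v = (take m v, drop (n - m) v)" for v :: "'b list"
  have fin: "finite ?X" and k: "card ?X \<ge> 2" using A by (auto simp: finite_automaton_def)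
  \<comment> \<open>From a state on the cycle \<open>a\<close>, an active path cannot disagree with
    the periodic word when at least \<open>m\<close> letters follow: these letters contain a second
    cycle, and the state on it is nontrivial because the final one is.\<close>
  have no_deviation: False
    if r: "r \<in> states A" and a: "a \<in> lists ?X" "a \<noteq> []" "state_section A r a = r"
      and p: "p @ c # e \<in> lists ?X" "c \<noteq> a ! (length p mod length a)" "m \<le> length e"
      and nt: "\<not> trivial_state A (state_section A r (p @ c # e))" for r a p c e
  proof -
    let ?r = "state_section A r (p @ [c])"
    have lists: "p @ [c] \<in> lists ?X" "e \<in> lists ?X" using p(1) by auto
    then have "?r \<in> states A" using r A by (intro state_section_closed)
    then obtain z1 z2 z3 where e: "e = z1 @ z2 @ z3" "z2 \<noteq> []"
      and rep: "state_section A (state_section A ?r z1) z2 = state_section A ?r z1"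
      using state_repetition[OF A _ lists(2) p(3)[unfolded m_def]] by metis
    have zs: "z1 \<in> lists ?X" "z2 \<in> lists ?X" "z3 \<in> lists ?X" using lists(2) by (auto simp: e)
    have eq: "state_section A ?r z1 = state_section A r (p @ c # z1)"
      by (simp flip: state_section_append)
    have "state_section A r (p @ c # e) = state_section A (state_section A ?r z1) (z2 @ z3)"
      by (simp add: e(1) flip: state_section_append)
    moreover have "z2 @ z3 \<in> lists ?X" using zs by simp
    ultimately have "\<not> trivial_state A (state_section A ?r z1)"
      using nt trivial_state_section by metis
    then show False
      using no_cycle_to_cycle[OF A C[OF r] a, of "p @ c # z1" "length p" z2] p(2) lists(1) zs e(2) rep
      unfolding eq by (auto simp: nth_append)
  qed
  have "inj_on ends (active_words A s n)"
  proof (rule inj_onI, rule ccontr)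
    fix v v' assume v: "v \<in> active_words A s n" and v': "v' \<in> active_words A s n"
      and eq: "ends v = ends v'" and ne: "v \<noteq> v'"
    have len: "length v = n" "length v' = n" and vX: "v \<in> lists ?X" "v' \<in> lists ?X"
      and nt: "\<not> trivial_state A (state_section A s v)" "\<not> trivial_state A (state_section A s v')"
      using v v' by (auto simp: active_words_def)
    obtain p c d e e' where "v = p @ [c] @ e" "v' = p @ [d] @ e'" "c \<noteq> d"
      using same_length_different[OF ne] len by metis
    then have pv: "v = p @ c # e" "v' = p @ d # e'" "c \<noteq> d" by simp_all
    \<comment> \<open>The words first differ right after \<open>p\<close>. Equal initial segments
      push this place beyond the first \<open>m\<close> letters; equal final segments will leave at
      least \<open>m\<close> letters behind it.\<close>
    have "m \<le> length p"
    proof (rule ccontr)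
      assume "\<not> m \<le> length p"
      then have "take m v ! length p = c" "take m v' ! length p = d"
        by (simp_all add: pv del: take_append)
      then show False using eq pv(3) by (simp add: ends_def)
    qed
    moreover have me: "m \<le> length e"
    proof (rule ccontr)
      assume "\<not> m \<le> length e"
      then have "n - m \<le> length p" using len by (auto simp: pv)
      then have "drop (n - m) v ! (length p - (n - m)) = c" "drop (n - m) v' ! (length p - (n - m)) = d"
        using len by (auto simp: pv nth_append)
      then show False using eq pv(3) by (simp add: ends_def)
    qed
    moreover have pX: "p \<in> lists ?X" using vX by (simp add: pv)
    ultimately obtain p1 a p2 where pa: "p = p1 @ a @ p2" "a \<noteq> []"
      and rep: "state_section A (state_section A s p1) a = state_section A s p1"
      using state_repetition[OF A s pX] by (metis m_def)
    define r where "r = state_section A s p1"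
    have aX: "p1 \<in> lists ?X" "a \<in> lists ?X" "p2 \<in> lists ?X" using pX by (auto simp: pa)
    then have r: "r \<in> states A" using A s unfolding r_def by (intro state_section_closed)
    have sec: "state_section A s (p @ f) = state_section A r (p2 @ f)" for f
      using rep by (simp add: pa r_def state_section_append)
    have e': "m \<le> length e'" using me len by (simp add: pv)
    have "p2 @ c # e \<in> lists ?X" "p2 @ d # e' \<in> lists ?X" using vX aX by (simp_all add: pv)
    \<comment> \<open>The cycle prescribes a single letter at this place, so at least one of the two
      words deviates from it there.\<close>
    moreover consider "c \<noteq> a ! (length p2 mod length a)" | "d \<noteq> a ! (length p2 mod length a)"
      using pv(3) by blast
    ultimately show False
      using no_deviation[OF r aX(2) pa(2) rep[folded r_def]] me e' nt[unfolded pv sec] by metis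
  qed
  \<comment> \<open>The minimum accounts for words shorter than \<open>m\<close>, both of whose ends
    are the whole word.\<close>
  moreover have "ends ` active_words A s n \<subseteq>
      {v \<in> lists ?X. length v = min n m} \<times> {v \<in> lists ?X. length v = min n m}"
    by (auto simp: ends_def active_words_def dest: in_set_takeD in_set_dropD)
  ultimately have "card (active_words A s n) \<le>
      card ({v \<in> lists ?X. length v = min n m} \<times> {v \<in> lists ?X. length v = min n m})"
    using fin by (intro card_inj_on_le[of ends] finite_cartesian_product finite_words)
  also have "\<dots> = card ?X ^ (2 * min n m)"
    by (simp add: card_cartesian_product card_words[OF fin] mult_2 power_add)
  also have "\<dots> \<le> card ?X ^ (2 * m)"
    using k by (intro power_increasing) auto
  finally show ?thesis by (simp add: m_def)
qed


section \<open>The construction on codes\<close>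

definition num_states :: "nat \<Rightarrow> nat" where
  "num_states a = code_length (psnd a)"

definition num_letters :: "nat \<Rightarrow> nat" where
  "num_letters a = pfst a"

definition output_code :: "nat \<Rightarrow> nat \<Rightarrow> nat \<Rightarrow> nat" where
  "output_code a s x = pfst (code_nth (code_nth (psnd a) s) x)"

definition target_code :: "nat \<Rightarrow> nat \<Rightarrow> nat \<Rightarrow> nat" where
  "target_code a s x = psnd (code_nth (code_nth (psnd a) s) x)"

text \<open>Triviality as a greatest fixed point: \<open>Z\<close> is a set of states that copy each
  letter and stay in \<open>Z\<close>. This makes it decidable from the table without a bound on the
  length of a word witnessing nontriviality.\<close>

definition trivial_code :: "nat \<Rightarrow> nat \<Rightarrow> bool" where
  "trivial_code a s \<longleftrightarrow> (\<exists>Z < 2 ^ num_states a. bit_set Z s \<and>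
     (\<forall>t<num_states a. bit_set Z t \<longrightarrow>
        (\<forall>x<num_letters a. output_code a t x = x \<and> bit_set Z (target_code a t x))))"

text \<open>For each state there are at most \<open>k ^ (2 * m)\<close> active words of a given
  length, and each contributes itself and its image as boundary points. The summand 1 admits an
  orbit that is a single tile, whatever the table.\<close>

definition label_bound :: "nat \<Rightarrow> nat" where
  "label_bound a = 2 * num_states a * num_letters a ^ (2 * num_states a) + 1"

definition vertex_bound :: "nat \<Rightarrow> nat" where
  "vertex_bound a = Suc (prod_encode (label_bound a, num_letters a))"

definition fact_bound :: "nat \<Rightarrow> nat" where
  "fact_bound a = Suc (prod_encode (num_states a + 2, prod_encode (label_bound a, label_bound a)))"

text \<open>A state of the acceptor is a set of facts coded by the bits of a number: fact \<open>(0, 0)\<close> marks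
  the state as accepting, \<open>(1, c)\<close> says that the current prefix lies in the class \<open>c\<close>, and
  \<open>(s + 2, (c, d))\<close> that the section \<open>s\<close> leads from the class \<open>c\<close> to the class \<open>d\<close>.\<close>

definition pointer_bit :: "nat \<Rightarrow> nat \<Rightarrow> bool" where
  "pointer_bit q c \<longleftrightarrow> bit_set q (prod_encode (1, c))"

definition edge_bit :: "nat \<Rightarrow> nat \<Rightarrow> nat \<Rightarrow> nat \<Rightarrow> bool" where
  "edge_bit q c s d \<longleftrightarrow> bit_set q (prod_encode (s + 2, prod_encode (c, d)))"

text \<open>The vertices of the inflated graph are the codes of the pairs of a class and a letter.\<close>

definition inflated_edge :: "nat \<Rightarrow> nat \<Rightarrow> nat \<Rightarrow> nat \<Rightarrow> nat \<Rightarrow> bool" where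
  "inflated_edge a q t u v \<longleftrightarrow> psnd u < num_letters a \<and>
     (\<exists>s<num_states a. edge_bit q (pfst u) s (pfst v) \<and>
        output_code a s (psnd u) = psnd v \<and> target_code a s (psnd u) = t)"

text \<open>With \<open>full\<close> the components represent orbits of the next level; without it
  only the edges that have just become trivial remain, and the components represent its
  tiles.\<close>

definition inflated_adjacent :: "nat \<Rightarrow> nat \<Rightarrow> bool \<Rightarrow> nat \<Rightarrow> nat \<Rightarrow> bool" where
  "inflated_adjacent a q full u v \<longleftrightarrow>
     (\<exists>t<num_states a. (full \<or> trivial_code a t) \<and> inflated_edge a q t u v)"

definition inflated_connected :: "nat \<Rightarrow> nat \<Rightarrow> bool \<Rightarrow> nat \<Rightarrow> nat \<Rightarrow> bool" where
  "inflated_connected a q full u v \<longleftrightarrow>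
     (\<forall>Z < 2 ^ vertex_bound a.
        (\<forall>c<vertex_bound a. \<forall>d<vertex_bound a.
           inflated_adjacent a q full c d \<longrightarrow> (bit_set Z c \<longleftrightarrow> bit_set Z d)) \<longrightarrow>
        bit_set Z u \<longrightarrow> bit_set Z v)"

definition class_rep :: "nat \<Rightarrow> nat \<Rightarrow> nat \<Rightarrow> nat" where
  "class_rep a q u = (LEAST v. v = vertex_bound a \<or> inflated_connected a q False u v)"

text \<open>A tile is numbered by the rank of its least vertex among the least vertices of all tiles
  in the component of \<open>r\<close>. The labels fill an initial segment of the numbers, so the
  bound on tiles also bounds them, although the inflated graph may have more vertices.\<close>

definition class_label :: "nat \<Rightarrow> nat \<Rightarrow> nat \<Rightarrow> nat \<Rightarrow> nat" where
  "class_label a q r u = (\<Sum>v<vertex_bound a. of_bool (inflated_connected a q True r v \<and>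
     class_rep a q v = v \<and> v < class_rep a q u))"

text \<open>Whether \<open>u x\<close> shares its orbit with some \<open>u y\<close> is visible only
  in the inflated graph, before the component of the root is renumbered. Therefore the result is
  stored as a flag in the state that is entered.\<close>

definition next_fact :: "nat \<Rightarrow> nat \<Rightarrow> nat \<Rightarrow> nat \<Rightarrow> bool" where
  "next_fact a q x i \<longleftrightarrow> (\<exists>c<label_bound a. pointer_bit q c \<and>
     ((i = prod_encode (0, 0) \<and> (\<exists>y<num_letters a. y \<noteq> x \<and>
         inflated_connected a q True (prod_encode (c, x)) (prod_encode (c, y)))) \<or>
      i = prod_encode (1, class_label a q (prod_encode (c, x)) (prod_encode (c, x))) \<or>
      (\<exists>u<vertex_bound a. \<exists>v<vertex_bound a. \<exists>t<num_states a.
         \<not> trivial_code a t \<and> inflated_connected a q True (prod_encode (c, x)) u \<and>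
         inflated_edge a q t u v \<and>
         i = prod_encode (t + 2, prod_encode (class_label a q (prod_encode (c, x)) u,
           class_label a q (prod_encode (c, x)) v)))))"

definition next_code :: "nat \<Rightarrow> nat \<Rightarrow> nat \<Rightarrow> nat" where
  "next_code a q x = bit_comprehension (fact_bound a) (\<lambda>i. next_fact a q x i)"

definition init_code :: "nat \<Rightarrow> nat" where
  "init_code a = bit_comprehension (fact_bound a) (\<lambda>i. i = prod_encode (1, 0) \<or>
     (\<exists>s<num_states a. \<not> trivial_code a s \<and> i = prod_encode (s + 2, prod_encode (0, 0))))"

text \<open>All numbers below \<open>2 ^ fact_bound a\<close> are listed as states, reachable or
  not, so each state is its own position in the table.\<close>

definition construct_code :: "nat \<Rightarrow> nat" where
  "construct_code a = list_encode [init_code a,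
     list_encode (map (\<lambda>q. list_encode (map (\<lambda>x. next_code a q x) [0..<num_letters a]))
       [0..<2 ^ fact_bound a]),
     list_encode (map (\<lambda>q. if bit_set q (prod_encode (0, 0)) then 1 else 0) [0..<2 ^ fact_bound a])]"

section \<open>Recursiveness of the construction\<close>

lemma total_recursive_num_states [recursive_intros]:
  assumes "total_recursive f"
  shows "total_recursive (\<lambda>n. num_states (f n))"
  unfolding num_states_def
  by (intro recursive_intros assms assms[THEN total_recursive.comp])

lemma total_recursive_num_letters [recursive_intros]:
  assumes "total_recursive f"
  shows "total_recursive (\<lambda>n. num_letters (f n))"
  unfolding num_letters_def
  by (intro recursive_intros assms assms[THEN total_recursive.comp])

lemma total_recursive_output_code [recursive_intros]:
  assumes "total_recursive f" "total_recursive g" "total_recursive h"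
  shows "total_recursive (\<lambda>n. output_code (f n) (g n) (h n))"
  unfolding output_code_def
  by (intro recursive_intros assms assms[THEN total_recursive.comp])

lemma total_recursive_target_code [recursive_intros]:
  assumes "total_recursive f" "total_recursive g" "total_recursive h"
  shows "total_recursive (\<lambda>n. target_code (f n) (g n) (h n))"
  unfolding target_code_def
  by (intro recursive_intros assms assms[THEN total_recursive.comp])

lemma total_recursive_bounds [recursive_intros]:
  assumes "total_recursive f"
  shows "total_recursive (\<lambda>n. label_bound (f n))"
    "total_recursive (\<lambda>n. vertex_bound (f n))"
    "total_recursive (\<lambda>n. fact_bound (f n))"
  unfolding label_bound_def vertex_bound_def fact_bound_def
  by (intro recursive_intros assms assms[THEN total_recursive.comp])+

lemma decidable_pointer_bit [recursive_intros]:
  assumes "total_recursive f" "total_recursive g"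
  shows "decidable (\<lambda>n. pointer_bit (f n) (g n))"
  unfolding pointer_bit_def
  by (intro recursive_intros assms assms[THEN total_recursive.comp])

lemma decidable_edge_bit [recursive_intros]:
  assumes "total_recursive f" "total_recursive g" "total_recursive h" "total_recursive i"
  shows "decidable (\<lambda>n. edge_bit (f n) (g n) (h n) (i n))"
  unfolding edge_bit_def
  by (intro recursive_intros assms assms[THEN total_recursive.comp])

lemma decidable_trivial_code [recursive_intros]:
  assumes "total_recursive f" "total_recursive g"
  shows "decidable (\<lambda>n. trivial_code (f n) (g n))"
  unfolding trivial_code_def
  by (intro recursive_intros assms assms[THEN total_recursive.comp])

lemma decidable_inflated_edge [recursive_intros]:
  assumes "total_recursive f" "total_recursive g" "total_recursive h" "total_recursive i" "total_recursive j"
  shows "decidable (\<lambda>n. inflated_edge (f n) (g n) (h n) (i n) (j n))"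
  unfolding inflated_edge_def
  by (intro recursive_intros assms assms[THEN total_recursive.comp])

lemma decidable_inflated_adjacent [recursive_intros]:
  assumes "total_recursive f" "total_recursive g" "total_recursive h" "total_recursive i"
  shows "decidable (\<lambda>n. inflated_adjacent (f n) (g n) b (h n) (i n))"
  unfolding inflated_adjacent_def
  by (intro recursive_intros assms assms[THEN total_recursive.comp])

lemma decidable_inflated_connected [recursive_intros]:
  assumes "total_recursive f" "total_recursive g" "total_recursive h" "total_recursive i"
  shows "decidable (\<lambda>n. inflated_connected (f n) (g n) b (h n) (i n))"
  unfolding inflated_connected_def
  by (intro recursive_intros assms assms[THEN total_recursive.comp])

lemma total_recursive_class_rep [recursive_intros]:
  assumes "total_recursive f" "total_recursive g" "total_recursive h"
  shows "total_recursive (\<lambda>n. class_rep (f n) (g n) (h n))"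
  unfolding class_rep_def
  by (intro recursive_intros assms assms[THEN total_recursive.comp])

lemma total_recursive_class_label [recursive_intros]:
  assumes "total_recursive f" "total_recursive g" "total_recursive h" "total_recursive i"
  shows "total_recursive (\<lambda>n. class_label (f n) (g n) (h n) (i n))"
  unfolding class_label_def
  by (intro recursive_intros assms assms[THEN total_recursive.comp])

lemma decidable_next_fact [recursive_intros]:
  assumes "total_recursive f" "total_recursive g" "total_recursive h" "total_recursive i"
  shows "decidable (\<lambda>n. next_fact (f n) (g n) (h n) (i n))"
  unfolding next_fact_def
  by (intro recursive_intros assms assms[THEN total_recursive.comp])

lemma total_recursive_next_code [recursive_intros]:
  assumes "total_recursive f" "total_recursive g" "total_recursive h"
  shows "total_recursive (\<lambda>n. next_code (f n) (g n) (h n))"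
  unfolding next_code_def
  by (intro recursive_intros assms assms[THEN total_recursive.comp])

lemma total_recursive_init_code [recursive_intros]:
  assumes "total_recursive f"
  shows "total_recursive (\<lambda>n. init_code (f n))"
  unfolding init_code_def
  by (intro recursive_intros assms assms[THEN total_recursive.comp])

lemma total_recursive_list_encode_Cons [recursive_intros]:
  assumes "total_recursive f" "total_recursive (\<lambda>n. list_encode (l n))"
  shows "total_recursive (\<lambda>n. list_encode (f n # l n))"
  by (simp, intro recursive_intros assms)

lemma total_recursive_construct_code: "total_recursive construct_code"
  unfolding construct_code_def by (intro recursive_intros)


section \<open>Orbits and tiles\<close>

text \<open>The predicate on the section selects edges of the Schreier graphs on the levels of the
  word tree: all of them for orbits, those with trivial section for tiles. Passing to
  \<open>equivclp\<close> accounts for inverses of generators.\<close>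

definition word_step :: "('s, 'x) automaton \<Rightarrow> ('s \<Rightarrow> bool) \<Rightarrow> 'x list \<Rightarrow> 'x list \<Rightarrow> bool" where
  "word_step A P u v \<longleftrightarrow>
     u \<in> lists (alphabet A) \<and> (\<exists>s\<in>states A. P (state_section A s u) \<and> v = act A s u)"

abbreviation word_connected :: "('s, 'x) automaton \<Rightarrow> ('s \<Rightarrow> bool) \<Rightarrow> 'x list \<Rightarrow> 'x list \<Rightarrow> bool" where
  "word_connected A P \<equiv> equivclp (word_step A P)"

abbreviation same_orbit :: "('s, 'x) automaton \<Rightarrow> 'x list \<Rightarrow> 'x list \<Rightarrow> bool" where
  "same_orbit A \<equiv> word_connected A (\<lambda>_. True)"

abbreviation same_tile :: "('s, 'x) automaton \<Rightarrow> 'x list \<Rightarrow> 'x list \<Rightarrow> bool" where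
  "same_tile A \<equiv> word_connected A (trivial_state A)"

text \<open>Since the group preserves prefixes, this says for words over the alphabet that the
  stabilizer of the prefix of length \<open>n\<close> moves the next letter.\<close>

definition orbit_grows :: "('s, 'x) automaton \<Rightarrow> 'x word \<Rightarrow> nat \<Rightarrow> bool" where
  "orbit_grows A w n \<longleftrightarrow>
     (\<exists>y\<in>alphabet A. y \<noteq> w n \<and> same_orbit A (prefix (Suc n) w) (prefix n w @ [y]))"

lemma word_connected_mono:
  assumes "word_connected A P u v" "\<And>s. P s \<Longrightarrow> Q s"
  shows "word_connected A Q u v"
  using assms(1)
proof (induction rule: equivclp_induct)
  case (step y z)
  then have "word_step A Q y z \<or> word_step A Q z y"
    using assms(2) unfolding word_step_def by blast
  with step.IH show ?case by (rule equivclp_into_equivclp)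
qed simp

lemma word_connected_length: "word_connected A P u v \<Longrightarrow> length v = length u"
  by (induction rule: equivclp_induct) (auto simp: word_step_def)

lemma word_connected_lists:
  assumes "finite_automaton A" "word_connected A P u v" "u \<in> lists (alphabet A)"
  shows "v \<in> lists (alphabet A)"
  using assms(2,3)
  by (induction rule: equivclp_induct) (auto simp: word_step_def dest: act_closed[OF assms(1)])

lemma prefix_Suc: "prefix (Suc n) w = prefix n w @ [w n]"
  by (simp add: subsequence_def)

lemma prefix_in_lists: "range w \<subseteq> X \<Longrightarrow> prefix n w \<in> lists X"
  by (auto simp: subsequence_def image_subset_iff)

section \<open>The automaton group acting on finite and infinite words\<close>

lemma carrier_BijGroup: "carrier (BijGroup S) = Bij S"
  by (simp add: BijGroup_def)

lemma one_BijGroup: "\<one>\<^bsub>BijGroup S\<^esub> = (\<lambda>x\<in>S. x)"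
  by (simp add: BijGroup_def)

lemma BijGroup_mult_apply:
  "g \<in> Bij S \<Longrightarrow> h \<in> Bij S \<Longrightarrow> u \<in> S \<Longrightarrow> (g \<otimes>\<^bsub>BijGroup S\<^esub> h) u = g (h u)"
  by (simp add: BijGroup_def compose_def)

lemma BijGroup_inv_apply:
  assumes "g \<in> Bij S" "u \<in> S"
  shows "(inv\<^bsub>BijGroup S\<^esub> g) u \<in> S" "g ((inv\<^bsub>BijGroup S\<^esub> g) u) = u"
proof -
  have i: "inv\<^bsub>BijGroup S\<^esub> g \<in> Bij S"
    using group.inv_closed[OF group_BijGroup, of g S] assms(1) by (simp add: carrier_BijGroup)
  then show "(inv\<^bsub>BijGroup S\<^esub> g) u \<in> S"
    using assms(2) by (rule funcset_mem[OF Bij_imp_funcset])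
  have "g \<otimes>\<^bsub>BijGroup S\<^esub> inv\<^bsub>BijGroup S\<^esub> g = (\<lambda>x\<in>S. x)"
    using group.r_inv[OF group_BijGroup, of g S] assms(1) by (simp add: carrier_BijGroup one_BijGroup)
  then show "g ((inv\<^bsub>BijGroup S\<^esub> g) u) = u"
    using BijGroup_mult_apply[OF assms(1) i assms(2)] assms(2) by simp
qed

context
  fixes A :: "('s, 'x) automaton"
  assumes fin: "finite_automaton A" and invertible: "invertible_automaton A"
begin

private abbreviation "X \<equiv> lists (alphabet A)"
private abbreviation "G \<equiv> BijGroup X"

lemma generators_subset: "transformation A ` states A \<subseteq> carrier G"
  using invertible by (auto simp: invertible_automaton_def carrier_BijGroup)

lemma automaton_group_subset: "automaton_group A \<subseteq> Bij X"
  using group.generate_incl[OF group_BijGroup generators_subset]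
  by (simp add: automaton_group_def carrier_BijGroup)

lemma automaton_group_closed: "g \<in> automaton_group A \<Longrightarrow> u \<in> X \<Longrightarrow> g u \<in> X"
  using automaton_group_subset Bij_imp_funcset by blast

lemma automaton_group_induct [consumes 1, case_names one generator inverse mult]:
  assumes "g \<in> automaton_group A"
    and "P (\<lambda>u\<in>X. u)"
    and "\<And>s. s \<in> states A \<Longrightarrow> P (transformation A s)"
    and "\<And>s. s \<in> states A \<Longrightarrow> P (inv\<^bsub>G\<^esub> (transformation A s))"
    and "\<And>g h. g \<in> automaton_group A \<Longrightarrow> h \<in> automaton_group A \<Longrightarrow> P g \<Longrightarrow> P h \<Longrightarrow> P (g \<otimes>\<^bsub>G\<^esub> h)"
  shows "P g"
  using assms(1) unfolding automaton_group_def
proof (induction rule: generate.induct)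
  case one
  then show ?case using assms(2) unfolding one_BijGroup .
qed (use assms(3-5) in \<open>auto simp: automaton_group_def\<close>)

lemma transformation_apply: "u \<in> X \<Longrightarrow> transformation A s u = act A s u"
  by (simp add: transformation_def)

lemma transformation_inverse:
  assumes "s \<in> states A" "u \<in> X"
  shows "(inv\<^bsub>G\<^esub> (transformation A s)) u \<in> X" "act A s ((inv\<^bsub>G\<^esub> (transformation A s)) u) = u"
proof -
  have s: "transformation A s \<in> Bij X" using assms invertible by (auto simp: invertible_automaton_def)
  show "(inv\<^bsub>G\<^esub> (transformation A s)) u \<in> X" by (rule BijGroup_inv_apply[OF s assms(2)])
  then show "act A s ((inv\<^bsub>G\<^esub> (transformation A s)) u) = u"
    using BijGroup_inv_apply(2)[OF s assms(2)] by (simp add: transformation_apply)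
qed

lemma act_inj: "s \<in> states A \<Longrightarrow> u \<in> X \<Longrightarrow> v \<in> X \<Longrightarrow> act A s u = act A s v \<Longrightarrow> u = v"
  using invertible unfolding invertible_automaton_def Bij_def bij_betw_def
  by (metis (no_types, lifting) IntD2 inj_onD mem_Collect_eq transformation_apply)

lemma automaton_group_apply_mult:
  "g \<in> automaton_group A \<Longrightarrow> h \<in> automaton_group A \<Longrightarrow> u \<in> X \<Longrightarrow> (g \<otimes>\<^bsub>G\<^esub> h) u = g (h u)"
  using automaton_group_subset by (intro BijGroup_mult_apply) auto

lemma automaton_group_same_orbit:
  "g \<in> automaton_group A \<Longrightarrow> u \<in> X \<Longrightarrow> same_orbit A u (g u)"
proof (induction arbitrary: u rule: automaton_group_induct)
  case (generator s)
  then have "word_step A (\<lambda>_. True) u (act A s u)" by (auto simp: word_step_def)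
  then show ?case using generator by (auto simp: transformation_apply)
next
  case (inverse s)
  then have "word_step A (\<lambda>_. True) ((inv\<^bsub>G\<^esub> (transformation A s)) u) u"
    unfolding word_step_def using transformation_inverse[OF inverse] by metis
  then show ?case by auto
next
  case (mult g h)
  then show ?case
    using equivclp_trans automaton_group_closed by (metis automaton_group_apply_mult)
qed auto

lemma automaton_group_prefix:
  "g \<in> automaton_group A \<Longrightarrow> u \<in> X \<Longrightarrow> g (take n u) = take n (g u)"
proof (induction arbitrary: u rule: automaton_group_induct)
  case one
  then show ?case by (auto dest: in_set_takeD)
next
  case (generator s)
  then have "take n u \<in> X" by (auto dest: in_set_takeD)
  moreover have "act A s (take n u) = take n (act A s u)"
    using act_append[of A s "take n u" "drop n u"] by (cases "n \<le> length u") auto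
  ultimately show ?case using generator by (simp add: transformation_apply)
next
  case (inverse s)
  let ?h = "inv\<^bsub>G\<^esub> (transformation A s)"
  have t: "take n u \<in> X" "take n (?h u) \<in> X"
    using inverse transformation_inverse(1)[OF inverse] by (auto dest: in_set_takeD)
  \<comment> \<open>The inverse is not itself given by \<open>act\<close>. Both sides of the claim
    have the same image under \<open>s\<close>, and \<open>s\<close> is injective.\<close>
  have "act A s (take n (?h u)) = take n (act A s (?h u))"
    using act_append[of A s "take n (?h u)" "drop n (?h u)"] by (cases "n \<le> length (?h u)") auto
  also have "\<dots> = act A s (?h (take n u))"
    using transformation_inverse(2) inverse t(1) by simp
  finally show ?case
    using act_inj[OF inverse(1)] t(2) transformation_inverse(1)[OF inverse(1) t(1)] by metis
next
  case (mult g h)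
  then have "take n u \<in> X" by (auto dest: in_set_takeD)
  with mult show ?case by (simp add: automaton_group_apply_mult automaton_group_closed del: in_lists_conv_set)
qed

lemma same_orbit_automaton_group:
  assumes "same_orbit A u v" "u \<in> X"
  shows "\<exists>g\<in>automaton_group A. v = g u"
  using assms
proof (induction rule: equivclp_induct)
  case base
  have "\<one>\<^bsub>G\<^esub> \<in> automaton_group A" by (simp add: automaton_group_def generate.one)
  with base show ?case by (auto simp: one_BijGroup intro!: bexI[of _ "\<lambda>u\<in>X. u"] simp del: in_lists_conv_set)
next
  case (step y z)
  then obtain g where g: "g \<in> automaton_group A" "y = g u" by blast
  have y: "y \<in> X" using g step.prems automaton_group_closed by blast
  from step(2) show ?case
  proof
    assume "word_step A (\<lambda>_. True) y z"
    then obtain s where s: "s \<in> states A" "z = act A s y" by (auto simp: word_step_def)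
    have t: "transformation A s \<in> automaton_group A"
      using s by (auto simp: automaton_group_def intro: generate.incl)
    then have "z = (transformation A s \<otimes>\<^bsub>G\<^esub> g) u"
      using s g y step.prems by (simp add: automaton_group_apply_mult transformation_apply del: in_lists_conv_set)
    moreover have "transformation A s \<otimes>\<^bsub>G\<^esub> g \<in> automaton_group A"
      using t g unfolding automaton_group_def by (intro generate.eng)
    ultimately show ?thesis by blast
  next
    assume "word_step A (\<lambda>_. True) z y"
    then obtain s where s: "s \<in> states A" "y = act A s z" "z \<in> X" by (auto simp: word_step_def)
    let ?i = "inv\<^bsub>G\<^esub> (transformation A s)"
    have t: "?i \<in> automaton_group A"
      using s by (auto simp: automaton_group_def intro: generate.inv)
    have "z = ?i y"
      using act_inj[OF s(1) s(3)] transformation_inverse[OF s(1) y] s(2) by metis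
    then have "z = (?i \<otimes>\<^bsub>G\<^esub> g) u"
      using g step.prems t by (simp add: automaton_group_apply_mult del: in_lists_conv_set)
    moreover have "?i \<otimes>\<^bsub>G\<^esub> g \<in> automaton_group A"
      using t g unfolding automaton_group_def by (intro generate.eng)
    ultimately show ?thesis by blast
  qed
qed

text \<open>\<open>omega_act\<close> takes one letter from the image of each prefix; these images
  are coherent because \<open>g\<close> commutes with truncation.\<close>

lemma prefix_omega_act:
  assumes g: "g \<in> automaton_group A" and w: "range w \<subseteq> alphabet A"
  shows "prefix n (omega_act g w) = g (prefix n w)"
proof (rule nth_equalityI)
  have len: "length (g (prefix n w)) = n" for n
    using word_connected_length[OF automaton_group_same_orbit[OF g prefix_in_lists[OF w]]] by simp
  then show "length (prefix n (omega_act g w)) = length (g (prefix n w))" by simp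
  fix i assume "i < length (prefix n (omega_act g w))"
  then have i: "i < n" by simp
  then have "take (Suc i) (prefix n w) = prefix (Suc i) w"
    by (simp add: subsequence_def take_map take_upt)
  then have "g (prefix (Suc i) w) = take (Suc i) (g (prefix n w))"
    using automaton_group_prefix[OF g prefix_in_lists[OF w]] by metis
  then have "omega_act g w i = g (prefix n w) ! i" by (simp add: omega_act_def)
  then show "prefix n (omega_act g w) ! i = g (prefix n w) ! i"
    using i by (simp add: subsequence_def)
qed

text \<open>Each \<open>n\<close> at which the orbit grows yields a point of the orbit that first
  deviates from \<open>w\<close> at \<open>n\<close>. Conversely, beyond the last such
  \<open>n\<close> a point of the orbit is determined by a finite prefix.\<close>

lemma finite_omega_orbit_iff:
  assumes w: "range w \<subseteq> alphabet A"
  shows "finite (omega_orbit A w) \<longleftrightarrow> finite {n. orbit_grows A w n}"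
proof
  assume fin_orbit: "finite (omega_orbit A w)"
  let ?f = "\<lambda>z. LEAST i. z i \<noteq> w i"
  have "{n. orbit_grows A w n} \<subseteq> ?f ` omega_orbit A w"
  proof safe
    fix n assume "orbit_grows A w n"
    then obtain y where y: "y \<noteq> w n" "same_orbit A (prefix (Suc n) w) (prefix n w @ [y])"
      by (auto simp: orbit_grows_def)
    then obtain g where g: "g \<in> automaton_group A" "prefix n w @ [y] = g (prefix (Suc n) w)"
      using same_orbit_automaton_group[OF _ prefix_in_lists[OF w]] by metis
    have "prefix (Suc n) (omega_act g w) = prefix n w @ [y]"
      using g(2) prefix_omega_act[OF g(1) w] by metis
    then have z: "prefix n (omega_act g w) = prefix n w" "omega_act g w n = y"
      by (simp_all add: prefix_Suc)
    have "?f (omega_act g w) = n"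
    proof (rule Least_equality)
      fix i assume *: "omega_act g w i \<noteq> w i"
      show "n \<le> i"
      proof (rule ccontr)
        assume "\<not> n \<le> i"
        then have "prefix n (omega_act g w) ! i = omega_act g w i" "prefix n w ! i = w i"
          by (simp_all add: subsequence_def)
        then show False using * z(1) by simp
      qed
    qed (use z y in simp)
    moreover have "omega_act g w \<in> omega_orbit A w" using g by (auto simp: omega_orbit_def)
    ultimately show "n \<in> ?f ` omega_orbit A w" by (rule rev_image_eqI[OF _ sym, rotated])
  qed
  then show "finite {n. orbit_grows A w n}" by (rule finite_surj[OF fin_orbit])
next
  assume "finite {n. orbit_grows A w n}"
  then obtain n0 where n0: "\<And>n. orbit_grows A w n \<Longrightarrow> n < n0"
    using finite_nat_set_iff_bounded by auto
  \<comment> \<open>Past \<open>n0\<close> the stabilizer of a prefix cannot move the next letter,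
    so fixing spreads from the prefix of length \<open>n0\<close> to all longer ones.\<close>
  have fixed: "k (prefix n w) = prefix n w"
    if k: "k \<in> automaton_group A" and k0: "k (prefix n0 w) = prefix n0 w" and "n0 \<le> n" for k n
    using \<open>n0 \<le> n\<close>
  proof (induction n rule: dec_induct)
    case (step n)
    let ?u = "prefix (Suc n) w"
    have u: "?u \<in> X" by (rule prefix_in_lists[OF w])
    have eq: "same_orbit A ?u (k ?u)" by (rule automaton_group_same_orbit[OF k u])
    have "take n ?u = prefix n w" by (simp add: prefix_Suc)
    then have t: "take n (k ?u) = prefix n w"
      using automaton_group_prefix[OF k u, of n] step.IH by metis
    have "length (k ?u) = Suc n" using word_connected_length[OF eq] by simp
    then have "k ?u = take n (k ?u) @ [k ?u ! n]"
      using take_Suc_conv_app_nth[of n "k ?u"] by simp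
    then obtain y where y: "k ?u = prefix n w @ [y]" unfolding t ..
    moreover have "k ?u \<in> X" by (rule automaton_group_closed[OF k u])
    ultimately have "y = w n"
      using n0[of n] step(1) eq by (auto simp: orbit_grows_def)
    then show ?case using y by (simp add: prefix_Suc)
  qed (rule k0)
  have "inj_on (prefix n0) (omega_orbit A w)"
  proof (rule inj_onI)
    fix x y assume "x \<in> omega_orbit A w" "y \<in> omega_orbit A w" and eq: "prefix n0 x = prefix n0 y"
    then obtain g h where gh: "g \<in> automaton_group A" "h \<in> automaton_group A"
      and xy: "x = omega_act g w" "y = omega_act h w" by (auto simp: omega_orbit_def)
    \<comment> \<open>If \<open>g w\<close> and \<open>h w\<close> share the prefix of length
      \<open>n0\<close>, then \<open>k\<close> fixes that prefix of \<open>w\<close>, hence all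
      longer ones, and \<open>g = h k\<close> makes the two points agree.\<close>
    define k where "k = inv\<^bsub>G\<^esub> h \<otimes>\<^bsub>G\<^esub> g"
    have sub: "subgroup (automaton_group A) G"
      unfolding automaton_group_def
      by (rule group.generate_is_subgroup[OF group_BijGroup generators_subset])
    have k: "k \<in> automaton_group A"
      unfolding k_def using gh by (intro subgroup.m_closed[OF sub] subgroup.m_inv_closed[OF sub])
    have "g = h \<otimes>\<^bsub>G\<^esub> k"
      using group.inv_solve_left[OF group_BijGroup, of k X h g] gh k subgroup.subset[OF sub]
      by (auto simp: k_def)
    then have g: "g u = h (k u)" if "u \<in> X" for u
      using automaton_group_apply_mult[OF gh(2) k that] by simp
    have "h (k (prefix n0 w)) = h (prefix n0 w)"
      using eq g[OF prefix_in_lists[OF w]] gh by (simp add: xy prefix_omega_act[OF _ w])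
    moreover have "inj_on h X"
      using gh(2) automaton_group_subset by (auto simp: Bij_def bij_betw_def)
    ultimately have "k (prefix n0 w) = prefix n0 w"
      using automaton_group_closed[OF k] prefix_in_lists[OF w] by (metis inj_onD)
    then have "k (prefix (Suc n + n0) w) = prefix (Suc n + n0) w" for n
      by (rule fixed[OF k]) simp
    then have "g (prefix (Suc n + n0) w) = h (prefix (Suc n + n0) w)" for n
      using g[OF prefix_in_lists[OF w]] by metis
    then have "prefix (Suc n + n0) x = prefix (Suc n + n0) y" for n
      unfolding xy by (metis prefix_omega_act[OF gh(1) w] prefix_omega_act[OF gh(2) w])
    then have "prefix (Suc n + n0) x ! n = prefix (Suc n + n0) y ! n" for n by simp
    moreover have "prefix (Suc n + n0) z ! n = z n" for z :: "'x word" and n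
      by (simp add: subsequence_def del: upt_Suc)
    ultimately show "x = y" by auto
  qed
  moreover have "prefix n0 z \<in> {v \<in> X. length v = n0}" if z: "z \<in> omega_orbit A w" for z
  proof -
    obtain g where "g \<in> automaton_group A" "z = omega_act g w"
      using z by (auto simp: omega_orbit_def)
    then have "prefix n0 z \<in> X"
      using automaton_group_closed[OF _ prefix_in_lists[OF w]] prefix_omega_act[OF _ w] by metis
    then show ?thesis by simp
  qed
  then have "prefix n0 ` omega_orbit A w \<subseteq> {v \<in> X. length v = n0}" by (rule image_subsetI)
  moreover have "finite (alphabet A)" using fin by (simp add: finite_automaton_def)
  ultimately show "finite (omega_orbit A w)" by (rule inj_on_finite[OF _ _ finite_words])
qed

end


section \<open>Presented automata\<close>

lemma position_enumerates:
  assumes "enumerates l S" "x \<in> S"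
  shows "position l x < length l" "l ! position l x = x"
proof -
  obtain i where "i < length l \<and> l ! i = x"
    using assms by (auto simp: enumerates_def in_set_conv_nth)
  then have "position l x < length l \<and> l ! position l x = x"
    unfolding position_def by (rule LeastI)
  then show "position l x < length l" "l ! position l x = x" by auto
qed

lemma position_nth: "distinct l \<Longrightarrow> i < length l \<Longrightarrow> position l (l ! i) = i"
  unfolding position_def by (rule Least_equality) (auto simp: nth_eq_iff_index_eq)

lemma position_eq_iff:
  "enumerates l S \<Longrightarrow> x \<in> S \<Longrightarrow> y \<in> S \<Longrightarrow> position l x = position l y \<longleftrightarrow> x = y"
  using position_enumerates by metis

text \<open>The component of \<open>u\<close> is itself a saturated set, and every saturated set
  containing \<open>u\<close> contains this component.\<close>

lemma bits_connected_iff: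
  assumes "u < V"
  shows "(\<forall>Z < 2 ^ V. (\<forall>c<V. \<forall>d<V. E c d \<longrightarrow> (bit_set Z c \<longleftrightarrow> bit_set Z d)) \<longrightarrow>
            bit_set Z u \<longrightarrow> bit_set Z v) \<longleftrightarrow>
         equivclp (\<lambda>c d. c < V \<and> d < V \<and> E c d) u v" (is "?L \<longleftrightarrow> equivclp ?E u v")
proof
  assume L: ?L
  define Z where "Z = bit_comprehension V (\<lambda>i. equivclp ?E u i)"
  have "Z < 2 ^ V" unfolding Z_def by (rule bit_comprehension_less)
  moreover have "bit_set Z c \<longleftrightarrow> bit_set Z d" if "c < V" "d < V" "E c d" for c d
  proof -
    have "equivclp ?E u c \<longleftrightarrow> equivclp ?E u d"
      using equivclp_into_equivclp[of ?E u c d] equivclp_into_equivclp[of ?E u d c] that by blast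
    then show ?thesis using that by (simp add: Z_def)
  qed
  moreover have "bit_set Z u" using assms by (simp add: Z_def)
  ultimately have "bit_set Z v" using L by blast
  then show "equivclp ?E u v" by (simp add: Z_def)
next
  assume "equivclp ?E u v"
  then show ?L by (induction rule: equivclp_induct) blast+
qed

lemma rank_less: "finite R \<Longrightarrow> (a :: nat) \<in> R \<Longrightarrow> card (R \<inter> {..<a}) < card R"
  by (rule psubset_card_mono) auto

lemma rank_eq_iff:
  assumes R: "finite R" "(a :: nat) \<in> R" "b \<in> R"
  shows "card (R \<inter> {..<a}) = card (R \<inter> {..<b}) \<longleftrightarrow> a = b"
proof -
  have "card (R \<inter> {..<c}) < card (R \<inter> {..<d})" if "c < d" "c \<in> R" for c d
    by (rule psubset_card_mono) (use R that in auto)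
  then show ?thesis using R by (metis less_irrefl linorder_neqE_nat)
qed

section \<open>An automaton and its table\<close>

locale presented_automaton =
  fixes A :: "('s, 'x) automaton" and ss :: "'s list" and xs :: "'x list" and a :: nat
  assumes bounded: "bounded_automaton A"
    and ss: "enumerates ss (states A)" and xs: "enumerates xs (alphabet A)"
    and code: "a = automaton_code ss xs A"
begin

abbreviation "X \<equiv> lists (alphabet A)"
abbreviation "spos \<equiv> position ss"
abbreviation "xpos \<equiv> position xs"

lemma fin: "finite_automaton A" and invertible: "invertible_automaton A"
  using bounded by (auto simp: bounded_automaton_def)

lemma finite_states: "finite (states A)" and finite_alphabet: "finite (alphabet A)"
  using fin by (auto simp: finite_automaton_def)

lemma lengths: "length ss = card (states A)" "length xs = card (alphabet A)"
  using ss xs distinct_card unfolding enumerates_def by metis+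

lemma num_letters: "num_letters a = card (alphabet A)"
  by (simp add: num_letters_def code automaton_code_def lengths)

lemma num_states: "num_states a = card (states A)"
  by (simp add: num_states_def code automaton_code_def lengths)

lemma spos_less: "s \<in> states A \<Longrightarrow> spos s < num_states a"
  using position_enumerates(1)[OF ss] by (simp add: num_states lengths)

lemma xpos_less: "x \<in> alphabet A \<Longrightarrow> xpos x < num_letters a"
  using position_enumerates(1)[OF xs] by (simp add: num_letters lengths)

lemma spos_surj:
  assumes "i < num_states a" obtains s where "s \<in> states A" "spos s = i"
proof (rule that)
  have "i < length ss" using assms by (simp add: num_states lengths)
  then show "ss ! i \<in> states A" "spos (ss ! i) = i"
    using ss nth_mem[of i ss] position_nth[of ss i] unfolding enumerates_def by blast+
qed

lemma xpos_surj:
  assumes "i < num_letters a" obtains x where "x \<in> alphabet A" "xpos x = i"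
proof (rule that)
  have "i < length xs" using assms by (simp add: num_letters lengths)
  then show "xs ! i \<in> alphabet A" "xpos (xs ! i) = i"
    using xs nth_mem[of i xs] position_nth[of xs i] unfolding enumerates_def by blast+
qed

lemmas spos_eq_iff = position_eq_iff[OF ss]
lemmas xpos_eq_iff = position_eq_iff[OF xs]

lemma code_step:
  assumes "s \<in> states A" "x \<in> alphabet A"
  shows "output_code a (spos s) (xpos x) = xpos (fst (step A (s, x)))"
    "target_code a (spos s) (xpos x) = spos (snd (step A (s, x)))"
  using position_enumerates[OF ss assms(1)] position_enumerates[OF xs assms(2)]
  by (simp_all add: output_code_def target_code_def code automaton_code_def split: prod.split)

lemma trivial_code_iff:
  assumes s: "s \<in> states A"
  shows "trivial_code a (spos s) \<longleftrightarrow> trivial_state A s"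
proof
  assume "trivial_code a (spos s)"
  then obtain Z where Z: "bit_set Z (spos s)"
    and closed: "\<And>t x. t < num_states a \<Longrightarrow> bit_set Z t \<Longrightarrow> x < num_letters a \<Longrightarrow>
      output_code a t x = x \<and> bit_set Z (target_code a t x)"
    unfolding trivial_code_def by blast
  have "act A t v = v" if "v \<in> X" "t \<in> states A" "bit_set Z (spos t)" for t v
    using that
  proof (induction v arbitrary: t rule: lists.induct)
    case (Cons x v)
    have "xpos (fst (step A (t, x))) = xpos x \<and> bit_set Z (spos (snd (step A (t, x))))"
      using closed[OF spos_less Cons.prems(2) xpos_less] Cons by (simp add: code_step)
    then have "fst (step A (t, x)) = x" "act A (snd (step A (t, x))) v = v"
      using Cons step_closed[OF fin] by (auto simp: xpos_eq_iff)
    then show ?case by (auto split: prod.split)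
  qed simp
  then show "trivial_state A s" using s Z by (auto simp: trivial_state_iff)
next
  assume triv: "trivial_state A s"
  \<comment> \<open>The largest admissible witness: all trivial states. It is closed because
    sections of trivial states are trivial.\<close>
  define Z where "Z = bit_comprehension (num_states a) (\<lambda>i. trivial_state A (ss ! i))"
  have bit: "bit_set Z (spos t) \<longleftrightarrow> trivial_state A t" if "t \<in> states A" for t
    using that position_enumerates[OF ss that] spos_less by (simp add: Z_def)
  have "output_code a t x = x \<and> bit_set Z (target_code a t x)"
    if t: "t < num_states a" and b: "bit_set Z t" and x: "x < num_letters a" for t x
  proof -
    obtain t' x' where t': "t' \<in> states A" "spos t' = t" and x': "x' \<in> alphabet A" "xpos x' = x"
      using spos_surj[OF t] xpos_surj[OF x] by metis
    have "trivial_state A t'" using b bit t' by blast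
    then have "fst (step A (t', x')) = x'" "trivial_state A (snd (step A (t', x')))"
      using trivial_state_step x'(1) by metis+
    then show ?thesis
      using code_step[OF t'(1) x'(1)] step_closed[OF fin t'(1) x'(1)] bit by (simp add: t' x')
  qed
  moreover have "Z < 2 ^ num_states a" unfolding Z_def by (rule bit_comprehension_less)
  ultimately show "trivial_code a (spos s)"
    unfolding trivial_code_def using bit[OF s] triv by blast
qed

lemma inflated_connected_iff:
  "u < vertex_bound a \<Longrightarrow> inflated_connected a q full u v \<longleftrightarrow>
     equivclp (\<lambda>c d. c < vertex_bound a \<and> d < vertex_bound a \<and> inflated_adjacent a q full c d) u v"
  unfolding inflated_connected_def by (rule bits_connected_iff)

lemma class_rep:
  assumes "u < vertex_bound a"
  shows "inflated_connected a q False u (class_rep a q u)" "class_rep a q u < vertex_bound a"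
proof -
  have u: "inflated_connected a q False u u" using assms by (simp add: inflated_connected_iff)
  have "class_rep a q u = vertex_bound a \<or> inflated_connected a q False u (class_rep a q u)"
    unfolding class_rep_def by (rule LeastI[of _ "vertex_bound a"]) simp
  \<comment> \<open>As \<open>u\<close> itself takes part in the search, the default
    \<open>vertex_bound a\<close> is never reached.\<close>
  moreover have "class_rep a q u \<le> u"
    unfolding class_rep_def by (rule Least_le) (simp add: u)
  ultimately show "inflated_connected a q False u (class_rep a q u)" "class_rep a q u < vertex_bound a"
    using assms by auto
qed

lemma class_rep_eq_iff:
  assumes "u < vertex_bound a" "v < vertex_bound a"
  shows "class_rep a q u = class_rep a q v \<longleftrightarrow> inflated_connected a q False u v"
proof
  assume eq: "class_rep a q u = class_rep a q v"
  then show "inflated_connected a q False u v"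
    using class_rep(1)[OF assms(1), of q] class_rep(1)[OF assms(2), of q] assms
    by (auto simp: inflated_connected_iff intro: equivclp_trans equivclp_sym)
next
  assume "inflated_connected a q False u v"
  then have "inflated_connected a q False u c \<longleftrightarrow> inflated_connected a q False v c" for c
    using assms by (auto simp: inflated_connected_iff intro: equivclp_trans equivclp_sym)
  then show "class_rep a q u = class_rep a q v" by (simp add: class_rep_def)
qed

text \<open>Tiles without a boundary point are invariant under the group, so an orbit with at least two
  tiles has at most as many tiles as boundary points.\<close>

lemma card_tiles_le:
  assumes w0: "w0 \<in> X" and orbit: "\<And>w. w \<in> R \<Longrightarrow> same_orbit A w0 w"
    and distinct_tiles: "\<And>w w'. w \<in> R \<Longrightarrow> w' \<in> R \<Longrightarrow> same_tile A w w' \<Longrightarrow> w = w'"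
  shows "card R \<le> label_bound a"
\<comment> \<open>An infinite \<open>R\<close> has \<open>card\<close> 0 and falls into the first
  case, so \<open>R\<close> is finite in the second.\<close>
proof (cases "card R \<le> 1")
  case True
  then show ?thesis by (simp add: label_bound_def)
next
  case False
  define n where "n = length w0"
  \<comment> \<open>Both ends of every step on level \<open>n\<close> whose section is
    nontrivial.\<close>
  define D where "D = (\<Union>s\<in>states A. active_words A s n \<union> act A s ` active_words A s n)"
  let ?B = "card (alphabet A) ^ (2 * card (states A))"
  have "finite R" using False card.infinite by force
  obtain C where C: "\<And>n s. s \<in> states A \<Longrightarrow> card (active_words A s n) \<le> C"
    using bounded by (auto simp: bounded_automaton_def active_words_def)
  have finD: "finite D" unfolding D_def using finite_states finite_active_words[OF finite_alphabet] by auto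
  have "card D \<le> (\<Sum>s\<in>states A. card (active_words A s n \<union> act A s ` active_words A s n))"
    unfolding D_def by (rule card_UN_le[OF finite_states])
  also have "\<dots> \<le> (\<Sum>s\<in>states A. 2 * ?B)"
  proof (rule sum_mono)
    fix s assume s: "s \<in> states A"
    have "card (active_words A s n \<union> act A s ` active_words A s n) \<le>
        card (active_words A s n) + card (act A s ` active_words A s n)"
      by (rule card_Un_le)
    also have "\<dots> \<le> 2 * card (active_words A s n)"
      using card_image_le[OF finite_active_words[OF finite_alphabet], of "act A s" s n] by simp
    also have "\<dots> \<le> 2 * ?B"
      using card_active_words_le[OF fin s C] by simp
    finally show "card (active_words A s n \<union> act A s ` active_words A s n) \<le> 2 * ?B" .
  qed
  finally have cardD: "card D \<le> label_bound a"
    by (simp add: label_bound_def num_states num_letters mult.commute mult.left_commute)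
  \<comment> \<open>A tile can be left only by a step with nontrivial section, and such a step has
    both ends in \<open>D\<close>. A tile that misses \<open>D\<close> is thus the whole orbit,
    against the presence of two tiles.\<close>
  have "\<exists>d\<in>D. same_tile A w d" if w: "w \<in> R" for w
  proof (rule ccontr)
    assume no_boundary: "\<not> (\<exists>d\<in>D. same_tile A w d)"
    have wn: "w \<in> X" "length w = n"
      using word_connected_lists[OF fin orbit[OF w] w0] word_connected_length[OF orbit[OF w]]
      by (auto simp: n_def)
    have "same_tile A w w'" if "same_orbit A w w'" for w'
      using that
    proof (induction rule: equivclp_induct)
      case (step y z)
      have "y \<in> X" "length y = n" "z \<in> X" "length z = n"
        using word_connected_lists[OF fin _ wn(1)] word_connected_length wn(2) step(1,2)
          equivclp_into_equivclp[OF step(1,2)] by metis+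
      have "word_step A (trivial_state A) y z \<or> word_step A (trivial_state A) z y"
      proof (rule ccontr)
        assume no_step: "\<not> (word_step A (trivial_state A) y z \<or> word_step A (trivial_state A) z y)"
        have "y \<notin> D" using no_boundary step.IH by blast
        show False
          using step(2)
        proof
          assume "word_step A (\<lambda>_. True) y z"
          then obtain s where s: "s \<in> states A" "z = act A s y" by (auto simp: word_step_def)
          have "\<not> trivial_state A (state_section A s y)"
            using s \<open>y \<in> X\<close> no_step by (auto simp: word_step_def)
          then have "y \<in> D" using s \<open>y \<in> X\<close> \<open>length y = n\<close> by (auto simp: D_def active_words_def)
          then show False using \<open>y \<notin> D\<close> by blast
        next
          assume "word_step A (\<lambda>_. True) z y"
          then obtain s where s: "s \<in> states A" "y = act A s z" by (auto simp: word_step_def)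
          have "\<not> trivial_state A (state_section A s z)"
            using s \<open>z \<in> X\<close> no_step by (auto simp: word_step_def)
          then have "z \<in> active_words A s n" using \<open>z \<in> X\<close> \<open>length z = n\<close> by (auto simp: active_words_def)
          then have "y \<in> D" using s by (auto simp: D_def)
          then show False using \<open>y \<notin> D\<close> by blast
        qed
      qed
      with step.IH show ?case by (rule equivclp_into_equivclp)
    qed simp
    then have "same_tile A w w'" if "w' \<in> R" for w'
      using orbit[OF w] orbit[OF that] equivclp_trans equivclp_sym by metis
    then have "R \<subseteq> {w}" using distinct_tiles[OF w] by blast
    then have "card R \<le> card {w}" by (intro card_mono) auto
    then show False using False by simp
  qed
  then obtain d where d: "\<And>w. w \<in> R \<Longrightarrow> d w \<in> D \<and> same_tile A w (d w)" by metis
  have "inj_on d R"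
  proof (rule inj_onI)
    fix w w' assume "w \<in> R" "w' \<in> R" "d w = d w'"
    then have "same_tile A w w'" using d equivclp_trans equivclp_sym by metis
    then show "w = w'" using distinct_tiles \<open>w \<in> R\<close> \<open>w' \<in> R\<close> by blast
  qed
  then have "card R \<le> card D" using d finD by (intro card_inj_on_le[of d]) auto
  with cardD show ?thesis by simp
qed

end


section \<open>Inflation of the tile graph\<close>

lemma prod_encode_pfst_psnd [simp]: "prod_encode (pfst n, psnd n) = n"
  by simp

context presented_automaton
begin

lemma act_snoc: "act A s (v @ [y]) = act A s v @ [fst (step A (state_section A s v, y))]"
  by (simp add: act_append split: prod.split)

lemma state_section_snoc:
  "state_section A s (v @ [y]) = snd (step A (state_section A s v, y))"
  by (simp add: state_section_append split: prod.split)

text \<open>The number \<open>q\<close> describes the orbit of \<open>u\<close>: its tiles, numbered by \<open>l\<close>, the tile of \<open>u\<close>, and the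
  transitions between tiles.\<close>

definition describes :: "('x list \<Rightarrow> nat) \<Rightarrow> nat \<Rightarrow> 'x list \<Rightarrow> bool" where
  "describes l q u \<longleftrightarrow> u \<in> X \<and>
     (\<forall>v w. same_orbit A u v \<longrightarrow> same_orbit A u w \<longrightarrow> (l v = l w \<longleftrightarrow> same_tile A v w)) \<and>
     (\<forall>v. same_orbit A u v \<longrightarrow> l v < label_bound a) \<and>
     (\<forall>c<label_bound a. pointer_bit q c \<longleftrightarrow> c = l u) \<and>
     (\<forall>t\<in>states A. \<forall>c d. edge_bit q c (spos t) d \<longleftrightarrow>
        (\<exists>v s. same_orbit A u v \<and> s \<in> states A \<and> state_section A s v = t \<and>
           \<not> trivial_state A t \<and> c = l v \<and> d = l (act A s v)))"

text \<open>The empty word is alone on its level: one tile, with a loop for each nontrivial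
  state.\<close>

lemma describes_init: "describes (\<lambda>_. 0) (init_code a) []"
proof -
  have orbit: "same_orbit A [] v \<longleftrightarrow> v = []" for v
    using word_connected_length[of A _ "[]" v] by auto
  have "label_bound a > 0" by (simp add: label_bound_def)
  moreover have "pointer_bit (init_code a) c \<longleftrightarrow> c = 0" if "c < label_bound a" for c
  proof -
    have "prod_encode (1, 0) < fact_bound a"
      unfolding fact_bound_def less_Suc_eq_le by (rule prod_encode_mono) auto
    then show ?thesis by (auto simp: pointer_bit_def init_code_def)
  qed
  moreover have "edge_bit (init_code a) c (spos t) d \<longleftrightarrow> \<not> trivial_state A t \<and> c = 0 \<and> d = 0"
    if t: "t \<in> states A" for t c d
  proof -
    have "prod_encode (spos t + 2, prod_encode (0, 0)) < fact_bound a"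
      unfolding fact_bound_def less_Suc_eq_le
      using spos_less[OF t] by (intro prod_encode_mono) auto
    then show ?thesis
      using spos_less[OF t] trivial_code_iff[OF t] by (auto simp: edge_bit_def init_code_def)
  qed
  ultimately show ?thesis by (auto simp: describes_def orbit)
qed

end

locale inflation = presented_automaton A ss xs a
  for A :: "('s, 'x) automaton" and ss xs a +
  fixes l :: "'x list \<Rightarrow> nat" and q :: nat and u :: "'x list"
  assumes describes: "describes l q u"
begin

abbreviation "in_orbit v \<equiv> same_orbit A u v"

lemma u_in: "u \<in> X"
  and label_eq_iff: "in_orbit v \<Longrightarrow> in_orbit w \<Longrightarrow> l v = l w \<longleftrightarrow> same_tile A v w"
  and label_less: "in_orbit v \<Longrightarrow> l v < label_bound a"
  and pointer_iff: "c < label_bound a \<Longrightarrow> pointer_bit q c \<longleftrightarrow> c = l u"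
  and edge_iff: "t \<in> states A \<Longrightarrow> edge_bit q c (spos t) d \<longleftrightarrow>
        (\<exists>v s. in_orbit v \<and> s \<in> states A \<and> state_section A s v = t \<and>
           \<not> trivial_state A t \<and> c = l v \<and> d = l (act A s v))"
  using describes unfolding describes_def by blast+

lemma in_orbit_X: "in_orbit v \<Longrightarrow> v \<in> X"
  using word_connected_lists[OF fin _ u_in] .

definition vertex :: "'x list \<Rightarrow> nat" where
  "vertex w = prod_encode (l (butlast w), xpos (last w))"

lemma vertex_snoc [simp]: "vertex (v @ [y]) = prod_encode (l v, xpos y)"
  by (simp add: vertex_def)

text \<open>Closed under all steps, but possibly a union of several orbits; the one through
  \<open>u @ [x]\<close> is singled out later as a component.\<close>

definition above :: "'x list set" where
  "above = {v @ [y] | v y. in_orbit v \<and> y \<in> alphabet A}"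

lemma aboveI: "in_orbit v \<Longrightarrow> y \<in> alphabet A \<Longrightarrow> v @ [y] \<in> above"
  by (auto simp: above_def)

lemma aboveE:
  assumes "w \<in> above" obtains v y where "w = v @ [y]" "in_orbit v" "y \<in> alphabet A"
  using assms by (auto simp: above_def)

lemma above_X: "above \<subseteq> X"
proof
  fix w assume "w \<in> above"
  then obtain v y where "w = v @ [y]" "in_orbit v" "y \<in> alphabet A" by (rule aboveE)
  then show "w \<in> X" using in_orbit_X[of v] by simp
qed

lemma vertex_less:
  assumes "w \<in> above" shows "vertex w < vertex_bound a"
proof -
  obtain v y where "w = v @ [y]" "in_orbit v" "y \<in> alphabet A" using assms by (rule aboveE)
  then show ?thesis
    unfolding vertex_bound_def less_Suc_eq_le
    using label_less[of v] xpos_less[of y] by (simp add: prod_encode_mono)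
qed

lemma orbit_step:
  assumes "v \<in> X" "s \<in> states A"
  shows "in_orbit (act A s v) \<longleftrightarrow> in_orbit v"
proof -
  have "word_step A (\<lambda>_. True) v (act A s v)" using assms by (auto simp: word_step_def)
  then show ?thesis by (meson equivclp_into_equivclp)
qed

text \<open>The last letter of the image of \<open>v @ [y]\<close> and the section there depend on
  \<open>s\<close> and \<open>v\<close> only through the section of \<open>s\<close> at
  \<open>v\<close>, which is what an edge of \<open>q\<close> records.\<close>

lemma inflated_edge_iff:
  assumes t: "t \<in> states A"
  shows "inflated_edge a q (spos t) b c \<longleftrightarrow>
    (\<exists>v y s. in_orbit v \<and> y \<in> alphabet A \<and> s \<in> states A \<and> \<not> trivial_state A (state_section A s v) \<and>
       state_section A s (v @ [y]) = t \<and> b = vertex (v @ [y]) \<and> c = vertex (act A s (v @ [y])))"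
    (is "?L \<longleftrightarrow> ?R")
proof
  assume ?L
  then obtain i where b: "psnd b < num_letters a" and i: "i < num_states a"
    "edge_bit q (pfst b) i (pfst c)" "output_code a i (psnd b) = psnd c" "target_code a i (psnd b) = spos t"
    unfolding inflated_edge_def by blast
  obtain y where y: "y \<in> alphabet A" "xpos y = psnd b" using xpos_surj[OF b] .
  obtain r where r: "r \<in> states A" "spos r = i" using spos_surj[OF i(1)] .
  obtain v s where v: "in_orbit v" "s \<in> states A" "state_section A s v = r" "\<not> trivial_state A r"
    "pfst b = l v" "pfst c = l (act A s v)"
    using i(2) edge_iff[OF r(1)] r(2) by auto
  have "psnd c = xpos (fst (step A (r, y)))" "spos t = spos (snd (step A (r, y)))"
    using code_step[OF r(1) y(1)] i r y by auto
  then have "state_section A s (v @ [y]) = t" "psnd c = xpos (fst (step A (r, y)))"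
    using v(3) t step_closed[OF fin r(1) y(1)] by (auto simp: state_section_snoc spos_eq_iff)
  moreover have "b = vertex (v @ [y])"
    using y v by (metis prod_encode_pfst_psnd vertex_snoc)
  moreover have "c = vertex (act A s (v @ [y]))"
    using calculation(2) v by (metis prod_encode_pfst_psnd vertex_snoc act_snoc)
  ultimately show ?R using v y by blast
next
  assume ?R
  then obtain v y s where v: "in_orbit v" "y \<in> alphabet A" "s \<in> states A"
    "\<not> trivial_state A (state_section A s v)" "state_section A s (v @ [y]) = t"
    "b = vertex (v @ [y])" "c = vertex (act A s (v @ [y]))" by blast
  let ?r = "state_section A s v"
  have r: "?r \<in> states A" using state_section_closed[OF fin v(3) in_orbit_X[OF v(1)]] .
  have "edge_bit q (l v) (spos ?r) (l (act A s v))"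
    using edge_iff[OF r] v by blast
  then show ?L
    unfolding inflated_edge_def using v spos_less[OF r] xpos_less[OF v(2)] code_step[OF r v(2)]
    by (auto simp: act_snoc state_section_snoc intro!: exI[of _ "spos ?r"])
qed

lemma inflated_adjacent_iff:
  "inflated_adjacent a q full b c \<longleftrightarrow>
    (\<exists>v y s. in_orbit v \<and> y \<in> alphabet A \<and> s \<in> states A \<and> \<not> trivial_state A (state_section A s v) \<and>
       (full \<or> trivial_state A (state_section A s (v @ [y]))) \<and>
       b = vertex (v @ [y]) \<and> c = vertex (act A s (v @ [y])))" (is "?L \<longleftrightarrow> ?R")
proof
  assume ?L
  then obtain i where i: "i < num_states a" "full \<or> trivial_code a i" "inflated_edge a q i b c"
    unfolding inflated_adjacent_def by blast
  obtain t where t: "t \<in> states A" "spos t = i" using spos_surj[OF i(1)] .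
  have "full \<or> trivial_state A t" using i(2) trivial_code_iff[OF t(1)] t(2) by simp
  moreover have "inflated_edge a q (spos t) b c" using i t by simp
  ultimately show ?R unfolding inflated_edge_iff[OF t(1)] by blast
next
  assume ?R
  then obtain v y s where v: "in_orbit v" "y \<in> alphabet A" "s \<in> states A"
    "\<not> trivial_state A (state_section A s v)" "full \<or> trivial_state A (state_section A s (v @ [y]))"
    "b = vertex (v @ [y])" "c = vertex (act A s (v @ [y]))" by blast
  let ?t = "state_section A s (v @ [y])"
  have "v @ [y] \<in> X" using above_X aboveI[OF v(1,2)] by blast
  then have t: "?t \<in> states A" by (rule state_section_closed[OF fin v(3)])
  have "inflated_edge a q (spos ?t) b c" unfolding inflated_edge_iff[OF t] using v by blast
  then show ?L
    unfolding inflated_adjacent_def using spos_less[OF t] trivial_code_iff[OF t] v(5) by blast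
qed

abbreviation "selected full t \<equiv> full \<or> trivial_state A t"

text \<open>If the section at the shorter word is trivial, the letter is copied and the tile kept,
  so the step does not change the vertex. Otherwise an edge of \<open>q\<close> records the
  step.\<close>

lemma step_above:
  assumes w: "word_step A (selected full) w w'" and above: "w \<in> above \<or> w' \<in> above"
  shows "w \<in> above \<and> w' \<in> above \<and>
    (vertex w = vertex w' \<or> inflated_adjacent a q full (vertex w) (vertex w'))"
proof -
  obtain s where s: "w \<in> X" "s \<in> states A" "selected full (state_section A s w)" "w' = act A s w"
    using w by (auto simp: word_step_def)
  have "w \<noteq> []" using above s(4) by (auto simp: above_def)
  then obtain v y where vy: "w = v @ [y]" by (metis append_butlast_last_id)
  have v: "v \<in> X" "y \<in> alphabet A" using s(1) vy by auto
  let ?r = "state_section A s v"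
  have r: "?r \<in> states A" by (rule state_section_closed[OF fin s(2) v(1)])
  have w': "w' = act A s v @ [fst (step A (?r, y))]" by (simp add: s(4) vy act_snoc)
  have "in_orbit v" using above orbit_step[OF v(1) s(2)] by (auto simp: w' vy above_def)
  moreover have "in_orbit (act A s v)" using calculation orbit_step[OF v(1) s(2)] by simp
  ultimately have orb: "in_orbit v" "in_orbit (act A s v)" by auto
  have mem: "w \<in> above" "w' \<in> above"
    unfolding w' vy using orb v(2) step_closed[OF fin r v(2)] by (auto intro: aboveI)
  show ?thesis
  proof (cases "trivial_state A ?r")
    case True
    then have "word_step A (trivial_state A) v (act A s v)" using v s by (auto simp: word_step_def)
    then have "l v = l (act A s v)" using label_eq_iff[OF orb] by blast
    then show ?thesis using mem trivial_state_step[OF True v(2)] by (simp add: w' vy)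
  next
    case False
    then have "inflated_adjacent a q full (vertex w) (vertex w')"
      unfolding inflated_adjacent_iff using orb v s vy by blast
    then show ?thesis using mem by blast
  qed
qed

lemma connected_above:
  assumes "word_connected A (selected full) w w'" "w \<in> above"
  shows "w' \<in> above \<and> inflated_connected a q full (vertex w) (vertex w')"
  using assms(1)
proof (induction rule: equivclp_induct)
  case base
  then show ?case using assms(2) vertex_less by (simp add: inflated_connected_iff)
next
  case (step y z)
  note iff = inflated_connected_iff[OF vertex_less[OF assms(2)]]
  have "y \<in> above" using step.IH by blast
  then have yz: "z \<in> above" "vertex y = vertex z \<or> inflated_adjacent a q full (vertex y) (vertex z) \<or>
      inflated_adjacent a q full (vertex z) (vertex y)"
    using step(2) step_above[of full y z] step_above[of full z y] by auto
  then show ?case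
    using step.IH vertex_less \<open>y \<in> above\<close> unfolding iff
    by (auto intro: equivclp_into_equivclp)
qed

text \<open>A trivial section copies the next letter and remains trivial. This is why a tile
  together with a letter is enough to name a vertex.\<close>

lemma same_tile_snoc:
  assumes "same_tile A v v'" "y \<in> alphabet A"
  shows "same_tile A (v @ [y]) (v' @ [y])"
  using assms(1)
proof (induction rule: equivclp_induct)
  case (step v1 v2)
  have "word_step A (trivial_state A) (v1 @ [y]) (v2 @ [y])"
    if vs: "word_step A (trivial_state A) v1 v2" for v1 v2
  proof -
    obtain s where s: "v1 \<in> X" "s \<in> states A" "trivial_state A (state_section A s v1)" "v2 = act A s v1"
      using vs by (auto simp: word_step_def)
    have "act A s (v1 @ [y]) = v2 @ [y]" "trivial_state A (state_section A s (v1 @ [y]))"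
      using trivial_state_step[OF s(3) assms(2)] s(4) by (simp_all add: act_snoc state_section_snoc)
    then show ?thesis using s assms(2) unfolding word_step_def by (metis append_in_lists_conv lists.simps)
  qed
  then show ?case using step by (blast intro: equivclp_into_equivclp)
qed simp

lemma vertex_eq:
  assumes "w \<in> above" "w' \<in> above" "vertex w = vertex w'"
  shows "same_tile A w w'"
proof -
  obtain v y v' y' where vy: "w = v @ [y]" "in_orbit v" "y \<in> alphabet A"
    "w' = v' @ [y']" "in_orbit v'" "y' \<in> alphabet A"
    using assms by (metis aboveE)
  then have "l v = l v'" "y = y'" using assms(3) by (auto simp: xpos_eq_iff)
  then show ?thesis using vy same_tile_snoc label_eq_iff by auto
qed

text \<open>Each edge of a path lifts to a step between words. Consecutive lifts need not meet, but
  where they should meet the two words have the same vertex, and \<open>vertex_eq\<close> joins them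
  inside a tile.\<close>

lemma inflated_connected_lift:
  assumes "inflated_connected a q full (vertex w) c" "w \<in> above"
  shows "\<exists>w'\<in>above. c = vertex w' \<and> word_connected A (selected full) w w'"
  using assms(1) unfolding inflated_connected_iff[OF vertex_less[OF assms(2)]]
proof (induction rule: equivclp_induct)
  case base
  show ?case by (intro bexI[of _ w] conjI refl equivclp_refl assms(2))
next
  case (step b c)
  then obtain w1 where w1: "w1 \<in> above" "b = vertex w1" "word_connected A (selected full) w w1" by blast
  have tile: "word_connected A (selected full) v v'" if "v \<in> above" "v' \<in> above" "vertex v = vertex v'" for v v'
    using vertex_eq[OF that] by (rule word_connected_mono) simp
  have adj: "\<exists>v v'. v \<in> above \<and> v' \<in> above \<and> b = vertex v \<and> c = vertex v' \<and> word_step A (selected full) v v'"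
    if bc: "inflated_adjacent a q full b c" for b c
  proof -
    obtain v y s where v: "in_orbit v" "y \<in> alphabet A" "s \<in> states A"
      "full \<or> trivial_state A (state_section A s (v @ [y]))"
      "b = vertex (v @ [y])" "c = vertex (act A s (v @ [y]))"
      using bc unfolding inflated_adjacent_iff by blast
    have ab: "v @ [y] \<in> above" using v aboveI by blast
    then have "word_step A (selected full) (v @ [y]) (act A s (v @ [y]))"
      unfolding word_step_def using v above_X by blast
    then show ?thesis using step_above ab v by blast
  qed
  obtain v v' where v: "v \<in> above" "v' \<in> above" "b = vertex v" "c = vertex v'"
      "word_step A (selected full) v v' \<or> word_step A (selected full) v' v"
    using step(2) adj[of b c] adj[of c b] by blast
  have "word_connected A (selected full) w v"
    using w1 v tile[of w1 v] by (metis equivclp_trans)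
  then have "word_connected A (selected full) w v'" using v(5) by (rule equivclp_into_equivclp)
  then show ?case using v by blast
qed

lemma inflated_connected_vertex_iff:
  assumes "w \<in> above" "w' \<in> above"
  shows "inflated_connected a q full (vertex w) (vertex w') \<longleftrightarrow> word_connected A (selected full) w w'"
proof
  assume "inflated_connected a q full (vertex w) (vertex w')"
  then obtain w1 where w1: "w1 \<in> above" "vertex w' = vertex w1" "word_connected A (selected full) w w1"
    using inflated_connected_lift assms(1) by blast
  have "word_connected A (selected full) w1 w'"
    using vertex_eq[OF w1(1) assms(2) w1(2)[symmetric]] by (rule word_connected_mono) simp
  with w1(3) show "word_connected A (selected full) w w'" by (rule equivclp_trans)
qed (use connected_above assms in blast)

lemmas connected_full_iff = inflated_connected_vertex_iff[of _ _ True, simplified]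
lemmas connected_tile_iff = inflated_connected_vertex_iff[of _ _ False, simplified]
lemmas same_orbit_above = connected_above[of True, simplified]
lemmas connected_full_lift = inflated_connected_lift[of True, simplified]

end


section \<open>The acceptor\<close>

context inflation
begin

section \<open>Numbering the tiles of the next level\<close>

definition next_label :: "'x \<Rightarrow> 'x list \<Rightarrow> nat" where
  "next_label x w = class_label a q (vertex (u @ [x])) (vertex w)"

context
  fixes x assumes x: "x \<in> alphabet A"
begin

lemma root_above: "u @ [x] \<in> above"
  using x by (intro aboveI) auto

definition next_reps :: "nat set" where
  "next_reps = {c. c < vertex_bound a \<and>
     inflated_connected a q True (vertex (u @ [x])) c \<and> class_rep a q c = c}"

lemma finite_next_reps: "finite next_reps"
  by (simp add: next_reps_def)

lemma next_label_eq: "next_label x w = card (next_reps \<inter> {..<class_rep a q (vertex w)})"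
proof -
  have "next_label x w = (\<Sum>c\<in>next_reps \<inter> {..<class_rep a q (vertex w)}. 1)"
    unfolding next_label_def class_label_def of_bool_def
    by (subst sum.inter_filter[symmetric])
      (auto simp: next_reps_def intro!: arg_cong[where f = card])
  then show ?thesis by simp
qed

lemma tile_imp_connected_full:
  assumes "c < vertex_bound a" "inflated_connected a q False c d"
  shows "inflated_connected a q True c d"
proof -
  have "equivclp (\<lambda>c d. c < vertex_bound a \<and> d < vertex_bound a \<and> inflated_adjacent a q False c d) c d"
    using assms by (simp add: inflated_connected_iff)
  then have "equivclp (\<lambda>c d. c < vertex_bound a \<and> d < vertex_bound a \<and> inflated_adjacent a q True c d) c d"
  proof (induction rule: equivclp_induct)
    case (step y z)
    then show ?case
      by (auto simp: inflated_adjacent_def elim!: equivclp_into_equivclp)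
  qed simp
  then show ?thesis using assms(1) by (simp add: inflated_connected_iff)
qed

lemma class_rep_in_next_reps:
  assumes "same_orbit A (u @ [x]) w"
  shows "class_rep a q (vertex w) \<in> next_reps"
proof -
  let ?c = "class_rep a q (vertex w)"
  have w: "w \<in> above" "inflated_connected a q True (vertex (u @ [x])) (vertex w)"
    using same_orbit_above[OF assms root_above] by auto
  have "inflated_connected a q True (vertex w) ?c"
    by (rule tile_imp_connected_full[OF vertex_less[OF w(1)] class_rep(1)[OF vertex_less[OF w(1)]]])
  then have "inflated_connected a q True (vertex (u @ [x])) ?c"
    using w(2) unfolding inflated_connected_iff[OF vertex_less[OF w(1)]]
      inflated_connected_iff[OF vertex_less[OF root_above]] by (rule equivclp_trans[rotated])
  moreover have "class_rep a q ?c = ?c"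
    using class_rep[OF vertex_less[OF w(1)]] class_rep_eq_iff[OF vertex_less[OF w(1)]] by metis
  ultimately show ?thesis
    using class_rep(2)[OF vertex_less[OF w(1)]] by (simp add: next_reps_def)
qed

text \<open>The representatives lift to words in the orbit of \<open>u @ [x]\<close> that lie in
  pairwise different tiles, to which the bound on tiles applies.\<close>

lemma card_next_reps_le: "card next_reps \<le> label_bound a"
proof -
  have "\<exists>w\<in>above. c = vertex w \<and> same_orbit A (u @ [x]) w" if "c \<in> next_reps" for c
    using connected_full_lift[OF _ root_above, of c] that by (simp add: next_reps_def)
  then obtain g where g: "\<And>c. c \<in> next_reps \<Longrightarrow> g c \<in> above \<and> c = vertex (g c) \<and> same_orbit A (u @ [x]) (g c)"
    by metis
  have inj: "inj_on g next_reps" using g by (metis inj_onI)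
  have eq: "c = d" if cd: "c \<in> next_reps" "d \<in> next_reps" "same_tile A (g c) (g d)" for c d
  proof -
    have "inflated_connected a q False c d"
      using connected_tile_iff[of "g c" "g d"] g[OF cd(1)] g[OF cd(2)] cd(3) by metis
    then have "class_rep a q c = class_rep a q d"
      using class_rep_eq_iff[of c d q] cd by (simp add: next_reps_def)
    then show "c = d" using cd by (simp add: next_reps_def)
  qed
  have "card (g ` next_reps) \<le> label_bound a"
  proof (rule card_tiles_le)
    show "u @ [x] \<in> X" using u_in x by simp
  qed (use g eq in auto)
  then show ?thesis by (simp add: card_image[OF inj])
qed

lemma next_label_less:
  "same_orbit A (u @ [x]) w \<Longrightarrow> next_label x w < label_bound a"
  unfolding next_label_eq
  using rank_less[OF finite_next_reps class_rep_in_next_reps] card_next_reps_le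
  by (rule less_le_trans)

lemma next_label_eq_iff:
  assumes "same_orbit A (u @ [x]) v" "same_orbit A (u @ [x]) w"
  shows "next_label x v = next_label x w \<longleftrightarrow> same_tile A v w"
proof -
  have vw: "v \<in> above" "w \<in> above" using assms same_orbit_above root_above by blast+
  have "next_label x v = next_label x w \<longleftrightarrow> class_rep a q (vertex v) = class_rep a q (vertex w)"
    unfolding next_label_eq using assms
    by (intro rank_eq_iff finite_next_reps class_rep_in_next_reps)
  also have "\<dots> \<longleftrightarrow> same_tile A v w"
    using class_rep_eq_iff vertex_less connected_tile_iff vw by metis
  finally show ?thesis .
qed

lemma next_fact_iff:
  "next_fact a q (xpos x) i \<longleftrightarrow>
     (i = prod_encode (0, 0) \<and> (\<exists>y\<in>alphabet A. y \<noteq> x \<and> same_orbit A (u @ [x]) (u @ [y]))) \<or>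
     i = prod_encode (1, next_label x (u @ [x])) \<or>
     (\<exists>w s. same_orbit A (u @ [x]) w \<and> s \<in> states A \<and> \<not> trivial_state A (state_section A s w) \<and>
        i = prod_encode (spos (state_section A s w) + 2,
          prod_encode (next_label x w, next_label x (act A s w))))"
    (is "_ \<longleftrightarrow> ?acc \<or> ?ptr \<or> ?edge")
proof -
  let ?r = "vertex (u @ [x])"
  have r: "prod_encode (l u, xpos x) = ?r" by simp
  \<comment> \<open>Exactly one pointer bit is set below \<open>label_bound a\<close>, so the
    quantifier over \<open>c\<close> merely reads off the tile of \<open>u\<close>.\<close>
  have one: "(\<exists>c<label_bound a. pointer_bit q c \<and> P c) \<longleftrightarrow> P (l u)" for P
    using pointer_iff label_less[of u] by auto
  have "next_fact a q (xpos x) i \<longleftrightarrow>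
     ((i = prod_encode (0, 0) \<and> (\<exists>y<num_letters a. y \<noteq> xpos x \<and>
         inflated_connected a q True ?r (prod_encode (l u, y)))) \<or>
      i = prod_encode (1, class_label a q ?r ?r) \<or>
      (\<exists>b<vertex_bound a. \<exists>c<vertex_bound a. \<exists>t<num_states a.
         \<not> trivial_code a t \<and> inflated_connected a q True ?r b \<and> inflated_edge a q t b c \<and>
         i = prod_encode (t + 2, prod_encode (class_label a q ?r b, class_label a q ?r c))))"
    by (simp only: next_fact_def one r)
  moreover have "(\<exists>y<num_letters a. y \<noteq> xpos x \<and> inflated_connected a q True ?r (prod_encode (l u, y)))
      \<longleftrightarrow> (\<exists>y\<in>alphabet A. y \<noteq> x \<and> same_orbit A (u @ [x]) (u @ [y]))" (is "?L \<longleftrightarrow> ?R")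
  proof -
    have iff: "inflated_connected a q True ?r (prod_encode (l u, xpos y)) \<longleftrightarrow>
        same_orbit A (u @ [x]) (u @ [y])" if "y \<in> alphabet A" for y
      using connected_full_iff[OF root_above, of "u @ [y]"] aboveI[of u y] that by simp
    show ?thesis
    proof
      assume ?L
      then obtain i where i: "i < num_letters a" "i \<noteq> xpos x"
        "inflated_connected a q True ?r (prod_encode (l u, i))" by blast
      obtain y where y: "y \<in> alphabet A" "xpos y = i" using xpos_surj[OF i(1)] .
      then have "y \<noteq> x" "same_orbit A (u @ [x]) (u @ [y])" using i iff[OF y(1)] by auto
      then show ?R using y(1) by blast
    next
      assume ?R
      then obtain y where "y \<in> alphabet A" "y \<noteq> x" "same_orbit A (u @ [x]) (u @ [y])" by blast
      then show ?L using iff[of y] xpos_less[of y] xpos_eq_iff[of y x] x by blast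
    qed
  qed
  moreover have "(\<exists>b<vertex_bound a. \<exists>c<vertex_bound a. \<exists>t<num_states a.
         \<not> trivial_code a t \<and> inflated_connected a q True ?r b \<and> inflated_edge a q t b c \<and>
         i = prod_encode (t + 2, prod_encode (class_label a q ?r b, class_label a q ?r c))) \<longleftrightarrow> ?edge"
    (is "?L \<longleftrightarrow> _")
  proof
    assume ?L
    then obtain b c k where k: "k < num_states a" "\<not> trivial_code a k"
      "inflated_connected a q True ?r b" "inflated_edge a q k b c"
      "i = prod_encode (k + 2, prod_encode (class_label a q ?r b, class_label a q ?r c))" by blast
    obtain t where t: "t \<in> states A" "spos t = k" using spos_surj[OF k(1)] .
    have nt: "\<not> trivial_state A t" using k(2) t trivial_code_iff by blast
    obtain v y s where v: "in_orbit v" "y \<in> alphabet A" "s \<in> states A"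
       "state_section A s (v @ [y]) = t" "b = vertex (v @ [y])" "c = vertex (act A s (v @ [y]))"
      using k(4) inflated_edge_iff[OF t(1), of b c] t(2) by blast
    have "same_orbit A (u @ [x]) (v @ [y])"
      using connected_full_iff[OF root_above aboveI[OF v(1,2)]] k(3) v(5) by blast
    then show ?edge
      using k(5) v nt t unfolding next_label_def by blast
  next
    assume ?edge
    then obtain w s where w: "same_orbit A (u @ [x]) w" "s \<in> states A"
        "\<not> trivial_state A (state_section A s w)"
        "i = prod_encode (spos (state_section A s w) + 2,
          prod_encode (next_label x w, next_label x (act A s w)))" by blast
    let ?t = "state_section A s w"
    have above: "w \<in> above" "inflated_connected a q True ?r (vertex w)"
      using same_orbit_above[OF w(1) root_above] by auto
    obtain v y where vy: "w = v @ [y]" "in_orbit v" "y \<in> alphabet A" using above(1) by (rule aboveE)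
    have wX: "w \<in> X" using above(1) above_X by blast
    have t: "?t \<in> states A" by (rule state_section_closed[OF fin w(2) wX])
    \<comment> \<open>A nontrivial section at the longer word forces one at the shorter word, so the
      old graph contains the edge from which this one arises.\<close>
    have "\<not> trivial_state A (state_section A s v)"
      using trivial_state_step(2)[OF _ vy(3)] w(3) by (auto simp: vy state_section_snoc)
    then have "inflated_edge a q (spos ?t) (vertex w) (vertex (act A s w))"
      unfolding inflated_edge_iff[OF t] using vy w(2) by blast
    moreover have "act A s w \<in> above"
    proof -
      have "word_step A (selected True) w (act A s w)" using wX w(2) by (auto simp: word_step_def)
      then show ?thesis using step_above above(1) by blast
    qed
    ultimately show ?L
      using vertex_less above spos_less[OF t] trivial_code_iff[OF t] w(3,4)
      unfolding next_label_def by blast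
  qed
  ultimately show ?thesis unfolding next_label_def by blast
qed

lemma accepting_next: "bit_set (next_code a q (xpos x)) (prod_encode (0, 0)) \<longleftrightarrow>
    (\<exists>y\<in>alphabet A. y \<noteq> x \<and> same_orbit A (u @ [x]) (u @ [y]))"
proof -
  have "prod_encode (0, 0) < fact_bound a"
    unfolding fact_bound_def less_Suc_eq_le by (intro prod_encode_mono) auto
  then show ?thesis unfolding next_code_def bit_set_comprehension next_fact_iff by auto
qed

lemma describes_next: "describes (next_label x) (next_code a q (xpos x)) (u @ [x])"
  unfolding describes_def
proof (intro conjI allI impI ballI)
  show "u @ [x] \<in> X" using u_in x by simp
next
  fix c assume c: "c < label_bound a"
  have "prod_encode (1, c) < fact_bound a"
    unfolding fact_bound_def less_Suc_eq_le
    using c le_prod_encode_1[of "label_bound a" "label_bound a"] by (intro prod_encode_mono) auto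
  then show "pointer_bit (next_code a q (xpos x)) c \<longleftrightarrow> c = next_label x (u @ [x])"
    unfolding pointer_bit_def next_code_def bit_set_comprehension next_fact_iff by auto
next
  fix t c d assume t: "t \<in> states A"
  let ?R = "\<exists>v s. same_orbit A (u @ [x]) v \<and> s \<in> states A \<and> state_section A s v = t \<and>
      \<not> trivial_state A t \<and> c = next_label x v \<and> d = next_label x (act A s v)"
  have "edge_bit (next_code a q (xpos x)) c (spos t) d \<longleftrightarrow>
      prod_encode (spos t + 2, prod_encode (c, d)) < fact_bound a \<and>
      (\<exists>w s. same_orbit A (u @ [x]) w \<and> s \<in> states A \<and> \<not> trivial_state A (state_section A s w) \<and>
        spos t = spos (state_section A s w) \<and> c = next_label x w \<and> d = next_label x (act A s w))"
    unfolding edge_bit_def next_code_def bit_set_comprehension next_fact_iff by auto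
  also have "\<dots> \<longleftrightarrow> prod_encode (spos t + 2, prod_encode (c, d)) < fact_bound a \<and> ?R"
  proof -
    have "spos t = spos (state_section A s w) \<longleftrightarrow> state_section A s w = t"
      if "same_orbit A (u @ [x]) w" "s \<in> states A" for w s
    proof -
      have "w \<in> X" using same_orbit_above[OF that(1) root_above] above_X by blast
      then show ?thesis using spos_eq_iff[OF t state_section_closed[OF fin that(2)]] by auto
    qed
    then show ?thesis by blast
  qed
  also have "\<dots> \<longleftrightarrow> ?R"
  proof -
    \<comment> \<open>\<open>next_code\<close> truncates at \<open>fact_bound a\<close>; no edge is
      lost because the labels of both ends stay below \<open>label_bound a\<close>.\<close>
    have "prod_encode (spos t + 2, prod_encode (c, d)) < fact_bound a" if R: ?R
    proof -
      obtain v s where v: "same_orbit A (u @ [x]) v" "s \<in> states A" "c = next_label x v"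
          "d = next_label x (act A s v)" using R by blast
      have "v \<in> X" using same_orbit_above[OF v(1) root_above] above_X by blast
      then have "word_step A (\<lambda>_. True) v (act A s v)" using v(2) by (auto simp: word_step_def)
      then have "same_orbit A (u @ [x]) (act A s v)" using v(1) equivclp_into_equivclp by metis
      then have "c < label_bound a" "d < label_bound a" using v next_label_less by auto
      then show ?thesis
        using spos_less[OF t] unfolding fact_bound_def less_Suc_eq_le
        by (intro prod_encode_mono) auto
    qed
    then show ?thesis by blast
  qed
  finally show "edge_bit (next_code a q (xpos x)) c (spos t) d \<longleftrightarrow> ?R" .
qed (use next_label_less next_label_eq_iff in auto)

end

end

context presented_automaton
begin

lemma describes_next:
  assumes "describes l q u" "x \<in> alphabet A"
  shows "\<exists>l'. describes l' (next_code a q (xpos x)) (u @ [x])"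
    "bit_set (next_code a q (xpos x)) (prod_encode (0, 0)) \<longleftrightarrow>
       (\<exists>y\<in>alphabet A. y \<noteq> x \<and> same_orbit A (u @ [x]) (u @ [y]))"
proof -
  interpret inflation A ss xs a l q u by unfold_locales (rule assms(1))
  show "\<exists>l'. describes l' (next_code a q (xpos x)) (u @ [x])"
    using describes_next[OF assms(2)] by blast
  show "bit_set (next_code a q (xpos x)) (prod_encode (0, 0)) \<longleftrightarrow>
       (\<exists>y\<in>alphabet A. y \<noteq> x \<and> same_orbit A (u @ [x]) (u @ [y]))"
    by (rule accepting_next[OF assms(2)])
qed

section \<open>The acceptor, its table and its runs\<close>

definition orbit_acceptor :: "(nat, 'x) acceptor" where
  "orbit_acceptor = \<lparr>acc_states = {..<2 ^ fact_bound a}, initial = init_code a,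
     trans_fun = \<lambda>q x. next_code a q (xpos x),
     accepting = {q. q < 2 ^ fact_bound a \<and> bit_set q (prod_encode (0, 0))}\<rparr>"

lemma next_code_less: "next_code a q x < 2 ^ fact_bound a"
  unfolding next_code_def by (rule bit_comprehension_less)

lemma init_code_less: "init_code a < 2 ^ fact_bound a"
  unfolding init_code_def by (rule bit_comprehension_less)

lemma finite_orbit_acceptor: "finite_acceptor (alphabet A) orbit_acceptor"
  by (auto simp: finite_acceptor_def orbit_acceptor_def next_code_less init_code_less)

lemma construct_code_eq:
  "construct_code a = acceptor_code [0..<2 ^ fact_bound a] xs orbit_acceptor"
proof -
  \<comment> \<open>In the enumeration \<open>[0..<n]\<close> positions and states coincide, so the
    computed numbers are already table entries.\<close>
  have pos: "position [0..<n] i = i" if "i < n" for i n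
    using position_nth[of "[0..<n]" i] that by simp
  have "map (\<lambda>i. next_code a q i) [0..<num_letters a] = map (\<lambda>x. next_code a q (xpos x)) xs" for q
  proof (rule nth_equalityI)
    fix i assume "i < length (map (\<lambda>i. next_code a q i) [0..<num_letters a])"
    then have "i < length xs" by (simp add: num_letters lengths)
    moreover have "distinct xs" using xs by (simp add: enumerates_def)
    ultimately show "map (\<lambda>i. next_code a q i) [0..<num_letters a] ! i =
        map (\<lambda>x. next_code a q (xpos x)) xs ! i"
      by (simp add: position_nth num_letters lengths)
  qed (simp add: num_letters lengths)
  then show ?thesis
    by (simp add: construct_code_def acceptor_code_def orbit_acceptor_def pos next_code_less
        init_code_less cong: map_cong)
      (intro arg_cong[where f = list_encode] map_cong; simp)
qed

lemma run_describes:
  assumes "range w \<subseteq> alphabet A"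
  shows "\<exists>l. describes l (run orbit_acceptor w n) (prefix n w)"
proof (induction n)
  case 0
  then show ?case using describes_init by (auto simp: orbit_acceptor_def)
next
  case (Suc n)
  then obtain l where "describes l (run orbit_acceptor w n) (prefix n w)" by blast
  moreover have "w n \<in> alphabet A" using assms by auto
  ultimately show ?case using describes_next(1) by (simp add: orbit_acceptor_def prefix_Suc)
qed

text \<open>The flag concerning the letter \<open>w n\<close> sits in the state entered by reading
  it, hence the shift by one.\<close>

lemma accepting_Suc_iff:
  assumes "range w \<subseteq> alphabet A"
  shows "run orbit_acceptor w (Suc n) \<in> accepting orbit_acceptor \<longleftrightarrow> orbit_grows A w n"
proof -
  obtain l where "describes l (run orbit_acceptor w n) (prefix n w)" using run_describes[OF assms] by blast
  moreover have "w n \<in> alphabet A" using assms by auto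
  ultimately show ?thesis
    using describes_next(2)
    by (simp add: orbit_acceptor_def orbit_grows_def prefix_Suc next_code_less)
qed

lemma finite_omega_orbit_iff_accepts:
  assumes "range w \<subseteq> alphabet A"
  shows "finite (omega_orbit A w) \<longleftrightarrow> accepts_finitely_often orbit_acceptor w"
proof -
  let ?S = "{i. run orbit_acceptor w i \<in> accepting orbit_acceptor}"
  \<comment> \<open>Index 0 belongs to the initial state, which no letter has led to; neither it nor
    the shift affects finiteness.\<close>
  have "?S \<subseteq> insert 0 (Suc ` {n. orbit_grows A w n})"
  proof
    fix i assume "i \<in> ?S"
    then show "i \<in> insert 0 (Suc ` {n. orbit_grows A w n})"
      using accepting_Suc_iff[OF assms] by (cases i) auto
  qed
  moreover have "Suc ` {n. orbit_grows A w n} \<subseteq> ?S" using accepting_Suc_iff[OF assms] by auto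
  ultimately have "finite ?S \<longleftrightarrow> finite {n. orbit_grows A w n}"
    using finite_subset finite_imageD[of Suc "{n. orbit_grows A w n}"] by (metis finite_imageI finite_insert inj_Suc)
  then show ?thesis
    using finite_omega_orbit_iff[OF fin invertible assms] by (simp add: accepts_finitely_often_def)
qed

end

theorem theorem1p2:
  shows "\<exists>construct :: nat \<Rightarrow> nat. total_recursive construct \<and>
    (\<forall>(A :: ('s, 'x) automaton) ss xs.
      bounded_automaton A \<and> enumerates ss (states A) \<and> enumerates xs (alphabet A) \<longrightarrow>
      (\<exists>(R :: (nat, 'x) acceptor) qs.
        finite_acceptor (alphabet A) R \<and> enumerates qs (acc_states R) \<and>
        construct (automaton_code ss xs A) = acceptor_code qs xs R \<and>
        (\<forall>w :: 'x word. range w \<subseteq> alphabet A \<longrightarrow>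
          (finite (omega_orbit A w) \<longleftrightarrow> accepts_finitely_often R w))))"
proof (intro exI[of _ construct_code] conjI allI impI total_recursive_construct_code)
  fix A :: "('s, 'x) automaton" and ss xs
  assume *: "bounded_automaton A \<and> enumerates ss (states A) \<and> enumerates xs (alphabet A)"
  interpret presented_automaton A ss xs "automaton_code ss xs A"
    by unfold_locales (use * in auto)
  have "enumerates [0..<2 ^ fact_bound (automaton_code ss xs A)] (acc_states orbit_acceptor)"
    by (auto simp: enumerates_def orbit_acceptor_def)
  then show "\<exists>(R :: (nat, 'x) acceptor) qs.
        finite_acceptor (alphabet A) R \<and> enumerates qs (acc_states R) \<and>
        construct_code (automaton_code ss xs A) = acceptor_code qs xs R \<and>
        (\<forall>w :: 'x word. range w \<subseteq> alphabet A \<longrightarrow>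
          (finite (omega_orbit A w) \<longleftrightarrow> accepts_finitely_often R w))"
    using finite_orbit_acceptor construct_code_eq finite_omega_orbit_iff_accepts by blast
qed

end
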